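(* Let $k\ge1$ and $r\ge0$. For all $u\in(\bigwedge^rV)[[\mathbf w_k]][\mathbf w_k^{-1}]$, $$\sigma_+(\mathbf z_k)[\mathbf b]^k_0\wedge u=\Big(\prod_{j=1}^kz_j^{\,r}\Big)\cdot\Gamma(\mathbf z_k)u,$$ the equality holding in $(\bigwedge^{r+k}V)[[\mathbf z_k,\mathbf w_k]][\mathbf w_k^{-1}]$. Here on the left-hand side $\sigma_+(\mathbf z_k)$ is applied only to $[\mathbf b]^k_0$.
   Context: $V=\bigoplus_{i\ge0}\mathbb Q b_i$, with the convention $b_i=0$ for $i<0$. $\mathcal P_r$ is the set of partitions of length at most $r$ (padded by zeros). For $\lambda\in\mathcal P_r$, $[\mathbf b]^r_\lambda=b_{r-1+\lambda_1}\wedge b_{r-2+\lambda_2}\wedge\cdots\wedge b_{\lambda_r}\in\bigwedge^rV$; these form a basis of $\bigwedge^rV$; subscript $0$ denotes the empty partition; $\bigwedge^0V=\mathbb Q$, $[\mathbf b]^0_0=1$. $\mathbf z_k=(z_1,\dots,z_k)$ and $\mathbf w_k=(w_1,\dots,w_k)$ are formal variables. $\sigma_+(z):\bigwedge V\to\bigwedge V[[z]]$ and $\overline\sigma_-(z):\bigwedge V\to\bigwedge V[z^{-1}]$ are the unique $\mathbb Q$-linear maps $D(z)$ with $D(z)1=1$, $D(z)(u\wedge v)=D(z)u\wedge D(z)v$, such that for all $j\ge0$: $\sigma_+(z)b_j=\sum_{i\ge0}b_{j+i}z^i$ and $\overline\sigma_-(z)b_j=b_j-b_{j-1}z^{-1}$.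 Put $\sigma_+(\mathbf z_k)=\sigma_+(z_1)\cdots\sigma_+(z_k)$ and $\overline\sigma_-(\mathbf z_k)=\overline\sigma_-(z_1)\cdots\overline\sigma_-(z_k)$. The vertex operator $\Gamma(\mathbf z_k)$ is defined by $$\Gamma(\mathbf z_k)[\mathbf b]^r_\lambda=\sigma_+(\mathbf z_k)\overline\sigma_-(\mathbf z_k)[\mathbf b]^{r+k}_\lambda\qquad(\lambda\in\mathcal P_r).$$ All operators are extended linearly (coefficientwise) over series in the other formal variables $\mathbf w_k$. *)

theory Defs
  imports "HOL-Library.Poly_Mapping" "HOL-Computational_Algebra.Formal_Laurent_Series"
begin

section \<open>The exterior algebra of the space with basis $b_0, b_1, \dots$\<close>

text \<open>
  An element of the exterior algebra is given by its coordinates with respect to the monomials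
  $b_{a_1} \wedge \dots \wedge b_{a_m}$, $a_1 > \dots > a_m$, which are indexed by the finite
  sets $\{a_1, \dots, a_m\}$ of natural numbers. That this is the exterior algebra is confirmed by
  \<open>bas_relations\<close> and \<open>ext_universal\<close> below.
\<close>

typedef ext = "{u :: nat set \<Rightarrow> rat. finite {A. u A \<noteq> 0} \<and> (\<forall>A. u A \<noteq> 0 \<longrightarrow> finite A)}"
  morphisms coord Abs_ext
  by (rule exI[of _ "\<lambda>_. 0"]) simp

setup_lifting type_definition_ext

lemma ext_eqI: "(\<And>A. coord u A = coord v A) \<Longrightarrow> u = v"
  by (metis coord_inject ext)

lemma finite_coord: "finite {A. coord u A \<noteq> 0}"
  using coord[of u] by simp

lemma coord_infinite: "infinite A \<Longrightarrow> coord u A = 0"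
  using coord[of u] by auto

text \<open>For disjoint \<open>A\<close>, \<open>B\<close>, the sign of the permutation that sorts the concatenation of the
  decreasing enumerations of \<open>A\<close> and of \<open>B\<close> into decreasing order.\<close>

definition shuffle_sign :: "nat set \<Rightarrow> nat set \<Rightarrow> rat" where
  "shuffle_sign A B = (- 1) ^ card {(a, b) \<in> A \<times> B. a < b}"

lemma shuffle_sign_empty [simp]: "shuffle_sign {} B = 1" "shuffle_sign A {} = 1"
  by (simp_all add: shuffle_sign_def)

lemma shuffle_sign_union_left:
  assumes "finite A" "finite A'" "finite B" "A \<inter> A' = {}"
  shows "shuffle_sign (A \<union> A') B = shuffle_sign A B * shuffle_sign A' B"
proof -
  have "{(a, b) \<in> (A \<union> A') \<times> B. a < b} = {(a, b) \<in> A \<times> B. a < b} \<union> {(a, b) \<in> A' \<times> B. a < b}"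
    by auto
  moreover have "finite {(a, b) \<in> A \<times> B. a < b}" "finite {(a, b) \<in> A' \<times> B. a < b}"
    using assms by (auto intro: finite_subset[of _ "A \<times> B"] finite_subset[of _ "A' \<times> B"])
  moreover have "{(a, b) \<in> A \<times> B. a < b} \<inter> {(a, b) \<in> A' \<times> B. a < b} = {}"
    using assms by auto
  ultimately show ?thesis
    by (simp add: shuffle_sign_def card_Un_disjoint power_add)
qed

lemma shuffle_sign_union_right:
  assumes "finite A" "finite B" "finite B'" "B \<inter> B' = {}"
  shows "shuffle_sign A (B \<union> B') = shuffle_sign A B * shuffle_sign A B'"
proof -
  have "{(a, b) \<in> A \<times> (B \<union> B'). a < b} = {(a, b) \<in> A \<times> B. a < b} \<union> {(a, b) \<in> A \<times> B'. a < b}"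
    by auto
  moreover have "finite {(a, b) \<in> A \<times> B. a < b}" "finite {(a, b) \<in> A \<times> B'. a < b}"
    using assms by (auto intro: finite_subset[of _ "A \<times> B"] finite_subset[of _ "A \<times> B'"])
  moreover have "{(a, b) \<in> A \<times> B. a < b} \<inter> {(a, b) \<in> A \<times> B'. a < b} = {}"
    using assms by auto
  ultimately show ?thesis
    by (simp add: shuffle_sign_def card_Un_disjoint power_add)
qed

text \<open>The ring structure of \<^typ>\<open>ext\<close>; its multiplication is the wedge product.\<close>

instantiation ext :: ring_1
begin

lift_definition zero_ext :: ext is "\<lambda>_. 0" by simp

lift_definition one_ext :: ext is "\<lambda>A. if A = {} then 1 else 0" by simp

lift_definition plus_ext :: "ext \<Rightarrow> ext \<Rightarrow> ext" is "\<lambda>u v A. u A + v A"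
  subgoal for u v
    by (rule conjI, rule finite_subset[of _ "{A. u A \<noteq> 0} \<union> {A. v A \<noteq> 0}"]) (auto, metis add_0)
  done

lift_definition uminus_ext :: "ext \<Rightarrow> ext" is "\<lambda>u A. - u A" by simp

lift_definition minus_ext :: "ext \<Rightarrow> ext \<Rightarrow> ext" is "\<lambda>u v A. u A - v A"
  subgoal for u v
    by (rule conjI, rule finite_subset[of _ "{A. u A \<noteq> 0} \<union> {A. v A \<noteq> 0}"]) (auto, metis)
  done

lift_definition times_ext :: "ext \<Rightarrow> ext \<Rightarrow> ext" is
  "\<lambda>u v C. \<Sum>A \<in> Pow C. shuffle_sign A (C - A) * u A * v (C - A)"
proof -
  fix u v :: "nat set \<Rightarrow> rat"
  assume u: "finite {A. u A \<noteq> 0} \<and> (\<forall>A. u A \<noteq> 0 \<longrightarrow> finite A)"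
    and v: "finite {A. v A \<noteq> 0} \<and> (\<forall>A. v A \<noteq> 0 \<longrightarrow> finite A)"
  let ?p = "\<lambda>C. \<Sum>A \<in> Pow C. shuffle_sign A (C - A) * u A * v (C - A)"
  have "{C. ?p C \<noteq> 0} \<subseteq> (\<lambda>(A, B). A \<union> B) ` ({A. u A \<noteq> 0} \<times> {A. v A \<noteq> 0})"
  proof
    fix C assume "C \<in> {C. ?p C \<noteq> 0}"
    then obtain A where "A \<in> Pow C" "shuffle_sign A (C - A) * u A * v (C - A) \<noteq> 0"
      by (auto elim: sum.not_neutral_contains_not_neutral)
    then show "C \<in> (\<lambda>(A, B). A \<union> B) ` ({A. u A \<noteq> 0} \<times> {A. v A \<noteq> 0})"
      by (auto intro!: image_eqI[of _ _ "(A, C - A)"])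
  qed
  moreover have "finite ((\<lambda>(A, B). A \<union> B) ` ({A. u A \<noteq> 0} \<times> {A. v A \<noteq> 0}))"
    using u v by simp
  ultimately have "finite {C. ?p C \<noteq> 0}"
    by (rule finite_subset)
  moreover have "\<forall>C. ?p C \<noteq> 0 \<longrightarrow> finite C"
    by (metis finite_Pow_iff sum.infinite)
  ultimately show "finite {C. ?p C \<noteq> 0} \<and> (\<forall>C. ?p C \<noteq> 0 \<longrightarrow> finite C)" ..
qed

instance
proof
  fix u v w :: ext
  show "u * v * w = u * (v * w)"
  proof (rule ext_eqI)
    fix C
    show "coord (u * v * w) C = coord (u * (v * w)) C"
    proof (cases "finite C")
      case True
      let ?s = shuffle_sign
      have "coord (u * v * w) C = (\<Sum>A\<in>Pow C. \<Sum>P\<in>Pow A.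
          ?s A (C - A) * (?s P (A - P) * coord u P * coord v (A - P)) * coord w (C - A))"
        by (simp add: times_ext.rep_eq sum_distrib_left sum_distrib_right)
      also have "\<dots> = (\<Sum>(A, P)\<in>Sigma (Pow C) Pow.
          ?s A (C - A) * (?s P (A - P) * coord u P * coord v (A - P)) * coord w (C - A))"
        by (intro sum.Sigma) (auto simp: True intro: finite_subset[OF _ True])
      also have "\<dots> = (\<Sum>(P, Q)\<in>Sigma (Pow C) (\<lambda>P. Pow (C - P)).
          ?s P (C - P) * coord u P * (?s Q (C - P - Q) * coord v Q * coord w (C - P - Q)))"
      proof (rule sum.reindex_bij_witness[where i = "\<lambda>(P, Q). (P \<union> Q, P)" and j = "\<lambda>(A, P). (P, A - P)"],
          goal_cases)
        case (5 x)
        obtain A P where x: "x = (A, P)" by fastforce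
        have sub: "A \<subseteq> C" "P \<subseteq> A" using 5 x by auto
        have "finite A" by (rule finite_subset[OF sub(1) True])
        moreover have "finite P" by (rule finite_subset[OF sub(2) \<open>finite A\<close>])
        ultimately have fin: "finite A" "finite P" "finite (A - P)" "finite (C - A)"
          using True by simp_all
        have "?s A (C - A) = ?s P (C - A) * ?s (A - P) (C - A)"
          using shuffle_sign_union_left[of P "A - P" "C - A"] fin sub by (simp add: Un_absorb1)
        moreover have "?s P (C - P) = ?s P (A - P) * ?s P (C - A)"
        proof -
          have "C - P = (A - P) \<union> (C - A)" using sub by auto
          then show ?thesis using shuffle_sign_union_right[of P "A - P" "C - A"] fin by auto
        qed
        moreover have "C - P - (A - P) = C - A" using sub by auto
        ultimately show ?case by (simp add: x)
      qed auto
      also have "\<dots> = (\<Sum>P\<in>Pow C. \<Sum>Q\<in>Pow (C - P).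
          ?s P (C - P) * coord u P * (?s Q (C - P - Q) * coord v Q * coord w (C - P - Q)))"
        by (intro sum.Sigma[symmetric]) (auto intro: True)
      also have "\<dots> = coord (u * (v * w)) C"
        by (simp add: times_ext.rep_eq sum_distrib_left)
      finally show ?thesis .
    qed (simp add: coord_infinite)
  qed
  show "1 * u = u"
  proof (rule ext_eqI)
    fix C
    show "coord (1 * u) C = coord u C"
    proof (cases "finite C")
      case True
      have "coord (1 * u) C = (\<Sum>A\<in>Pow C. if A = {} then coord u C else 0)"
        unfolding times_ext.rep_eq one_ext.rep_eq by (intro sum.cong) auto
      then show ?thesis using True by simp
    qed (simp add: coord_infinite)
  qed
  show "u * 1 = u"
  proof (rule ext_eqI)
    fix C
    show "coord (u * 1) C = coord u C"
    proof (cases "finite C")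
      case True
      have "coord (u * 1) C = (\<Sum>A\<in>Pow C. if A = C then coord u C else 0)"
        unfolding times_ext.rep_eq one_ext.rep_eq by (intro sum.cong) auto
      then show ?thesis using True by simp
    qed (simp add: coord_infinite)
  qed
  show "(u + v) * w = u * w + v * w"
    by (rule ext_eqI) (simp add: times_ext.rep_eq plus_ext.rep_eq algebra_simps sum.distrib)
  show "u * (v + w) = u * v + u * w"
    by (rule ext_eqI) (simp add: times_ext.rep_eq plus_ext.rep_eq algebra_simps sum.distrib)
  show "(0 :: ext) \<noteq> 1"
    by (metis one_ext.rep_eq zero_ext.rep_eq zero_neq_one)
qed (transfer; simp add: fun_eq_iff)+

end

lift_definition scaleQ :: "rat \<Rightarrow> ext \<Rightarrow> ext" is "\<lambda>c u A. c * u A"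
  subgoal for c u by (rule conjI, rule finite_subset[of _ "{A. u A \<noteq> 0}"]) auto
  done

lemma vector_space_scaleQ: "vector_space scaleQ"
  by unfold_locales (rule ext_eqI, simp add: scaleQ.rep_eq plus_ext.rep_eq algebra_simps)+

lemma scaleQ_mult: "scaleQ c u * v = scaleQ c (u * v)" "u * scaleQ c v = scaleQ c (u * v)"
  by (rule ext_eqI, simp add: scaleQ.rep_eq times_ext.rep_eq sum_distrib_left mult_ac)+

lift_definition monom_ext :: "nat set \<Rightarrow> ext" is "\<lambda>A B. if finite A \<and> B = A then 1 else 0"
  subgoal for A by (rule conjI, rule finite_subset[of _ "{A}"]) auto
  done

lemma monom_ext_mult:
  assumes "finite A" "finite B"
  shows "monom_ext A * monom_ext B =
    (if A \<inter> B = {} then scaleQ (shuffle_sign A B) (monom_ext (A \<union> B)) else 0)"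
proof (rule ext_eqI)
  fix C
  show "coord (monom_ext A * monom_ext B) C =
    coord (if A \<inter> B = {} then scaleQ (shuffle_sign A B) (monom_ext (A \<union> B)) else 0) C"
  proof (cases "finite C")
    case True
    have "coord (monom_ext A * monom_ext B) C =
        (\<Sum>A'\<in>Pow C. if A' = A then (if C - A = B then shuffle_sign A B else 0) else 0)"
      unfolding times_ext.rep_eq monom_ext.rep_eq using assms by (intro sum.cong) auto
    also have "\<dots> = (if A \<subseteq> C \<and> C - A = B then shuffle_sign A B else 0)"
      using True by simp
    also have "A \<subseteq> C \<and> C - A = B \<longleftrightarrow> A \<inter> B = {} \<and> C = A \<union> B"
      by auto
    finally show ?thesis
      using assms by (auto simp: scaleQ.rep_eq monom_ext.rep_eq zero_ext.rep_eq)
  qed (simp add: coord_infinite)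
qed

lemma coord_sum: "coord (sum f S) A = (\<Sum>x\<in>S. coord (f x) A)"
  by (induction S rule: infinite_finite_induct) (auto simp: zero_ext.rep_eq plus_ext.rep_eq)

lemma ext_expand: "u = (\<Sum>A | coord u A \<noteq> 0. scaleQ (coord u A) (monom_ext A))"
proof (rule ext_eqI)
  fix B
  have "coord (\<Sum>A | coord u A \<noteq> 0. scaleQ (coord u A) (monom_ext A)) B =
      (\<Sum>A | coord u A \<noteq> 0. if A = B then coord u A else 0)"
    unfolding coord_sum scaleQ.rep_eq monom_ext.rep_eq
    by (intro sum.cong) (auto simp: coord_infinite)
  also have "\<dots> = coord u B"
    using finite_coord[of u] by simp
  finally show "coord u B = coord (\<Sum>A | coord u A \<noteq> 0. scaleQ (coord u A) (monom_ext A)) B" ..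
qed

text \<open>The basis vectors of $V$, with $b_i = 0$ for negative $i$.\<close>

definition bas :: "int \<Rightarrow> ext" where
  "bas i = (if i < 0 then 0 else monom_ext {nat i})"

lemma bas_relations: "bas i * bas i = 0" "bas i * bas j = - (bas j * bas i)"
proof -
  show "bas i * bas i = 0"
    by (simp add: bas_def monom_ext_mult)
  show "bas i * bas j = - (bas j * bas i)"
  proof (cases "i < 0 \<or> j < 0 \<or> i = j")
    case True
    then show ?thesis by (auto simp: bas_def monom_ext_mult)
  next
    case False
    then have ne: "nat i \<noteq> nat j" "nat i < nat j \<longleftrightarrow> i < j" "nat j < nat i \<longleftrightarrow> j < i" by auto
    have s: "shuffle_sign {x} {y} = (if x < y then - 1 else 1)" for x y
    proof -
      have "{(a, b) \<in> {x} \<times> {y}. a < b} = (if x < y then {(x, y)} else {})" by auto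
      then show ?thesis by (simp add: shuffle_sign_def)
    qed
    show ?thesis
      using False ne by (intro ext_eqI)
        (auto simp: bas_def monom_ext_mult s scaleQ.rep_eq uminus_ext.rep_eq insert_commute)
  qed
qed

lemma bas_mult_monom_ext:
  assumes "finite A" "\<forall>a\<in>A. a < m"
  shows "bas (int m) * monom_ext A = monom_ext (insert m A)"
proof -
  have "{(a, b) \<in> {m} \<times> A. a < b} = {}" using assms by auto
  then have "shuffle_sign {m} A = 1" unfolding shuffle_sign_def by (metis card.empty power_0)
  then show ?thesis
    using assms by (auto simp: bas_def monom_ext_mult intro!: ext_eqI simp: scaleQ.rep_eq)
qed

lemma one_ext_monom: "1 = monom_ext {}"
  by (rule ext_eqI) (simp add: one_ext.rep_eq monom_ext.rep_eq)

text \<open>The universal property of the exterior algebra; \<open>\<iota>\<close> is the structure map of a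
  $\mathbb{Q}$-algebra.\<close>

context
  fixes f :: "nat \<Rightarrow> 'a :: ring_1" and \<iota> :: "rat \<Rightarrow> 'a"
  assumes iota: "\<And>c d. \<iota> (c + d) = \<iota> c + \<iota> d" "\<And>c d. \<iota> (c * d) = \<iota> c * \<iota> d" "\<iota> 1 = 1"
      "\<And>c x. \<iota> c * x = x * \<iota> c"
    and f: "\<And>i. f i * f i = 0" "\<And>i j. f i * f j = - (f j * f i)"
begin

private definition F :: "nat set \<Rightarrow> 'a" where
  "F A = prod_list (map f (rev (sorted_list_of_set A)))"

private lemma iota_0 [simp]: "\<iota> 0 = 0"
  using iota(1)[of 0 0] by simp

private lemma iota_uminus [simp]: "\<iota> (- c) = - \<iota> c"
  using iota(1)[of c "- c"] by (simp add: add_eq_0_iff)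

private lemma iota_left_commute: "x * (\<iota> c * y) = \<iota> c * (x * y)"
  by (metis iota(4) mult.assoc)

private lemma F_empty [simp]: "F {} = 1"
  by (simp add: F_def)

private lemma F_insert:
  assumes "finite A" "\<forall>a\<in>A. a < m"
  shows "F (insert m A) = f m * F A"
proof -
  have "m \<notin> A" using assms(2) by blast
  then have "sorted_list_of_set (insert m A) = sorted_list_of_set A @ [m]"
    using assms by (auto simp: sorted_insort_is_snoc less_imp_le)
  then show ?thesis by (simp add: F_def)
qed

private lemma f_mult_F:
  "finite B \<Longrightarrow>
    f a * F B = (if a \<in> B then 0 else \<iota> (shuffle_sign {a} B) * F (insert a B))"
proof (induction B rule: finite_linorder_max_induct)
  case empty
  then show ?case by (simp add: F_insert iota(3))
next
  case (insert m B)
  consider "m < a" | "m = a" | "a < m" by linarith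
  then show ?case
  proof cases
    case 1
    then have "{(x, y) \<in> {a} \<times> insert m B. x < y} = {}" using insert.hyps(2) by auto
    then have "shuffle_sign {a} (insert m B) = 1" unfolding shuffle_sign_def by (metis card.empty power_0)
    moreover have "\<forall>x\<in>insert m B. x < a" using 1 insert.hyps(2) by auto
    ultimately show ?thesis
      using insert.hyps(1) by (auto simp: F_insert[of "insert m B" a] iota(3))
  next
    case 2
    then show ?thesis using insert.hyps f(1)[of a] by (simp add: F_insert mult.assoc[symmetric])
  next
    case 3
    have "f a * F (insert m B) = - (f m * (f a * F B))"
      using insert.hyps f(2)[of a m] by (simp add: F_insert mult.assoc[symmetric])
    also have "\<dots> = (if a \<in> B then 0 else - \<iota> (shuffle_sign {a} B) * (f m * F (insert a B)))"
      using insert.IH by (simp add: iota_left_commute)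
    also have "f m * F (insert a B) = F (insert a (insert m B))"
      using F_insert[of "insert a B" m] insert.hyps 3 by (auto simp: insert_commute)
    also have "- \<iota> (shuffle_sign {a} B) = \<iota> (shuffle_sign {a} (insert m B))"
    proof -
      have "{(x, y) \<in> {a} \<times> {m}. x < y} = {(a, m)}" using 3 by auto
      then have "shuffle_sign {a} {m} = - 1" by (simp add: shuffle_sign_def)
      moreover have "m \<notin> B" using insert.hyps(2) by blast
      ultimately have "shuffle_sign {a} (insert m B) = - shuffle_sign {a} B"
        using shuffle_sign_union_right[of "{a}" "{m}" B] insert.hyps(1) by simp
      then show ?thesis by simp
    qed
    finally show ?thesis using 3 by auto
  qed
qed

private lemma F_mult:
  "finite A \<Longrightarrow> finite B \<Longrightarrow>
    F A * F B = (if A \<inter> B = {} then \<iota> (shuffle_sign A B) * F (A \<union> B) else 0)"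
proof (induction A rule: finite_linorder_max_induct)
  case empty
  then show ?case by (simp add: iota(3))
next
  case (insert m A)
  have m: "m \<notin> A" using insert.hyps(2) by blast
  have "F (insert m A) * F B = f m * (F A * F B)"
    using insert.hyps by (simp add: F_insert mult.assoc)
  also have "\<dots> = (if A \<inter> B = {} then \<iota> (shuffle_sign A B) * (f m * F (A \<union> B)) else 0)"
    using insert by (simp add: iota_left_commute)
  also have "f m * F (A \<union> B) =
      (if m \<in> B then 0 else \<iota> (shuffle_sign {m} (A \<union> B)) * F (insert m (A \<union> B)))"
    using f_mult_F[of "A \<union> B" m] insert.hyps insert.prems m by simp
  finally have *: "F (insert m A) * F B = (if A \<inter> B = {} \<and> m \<notin> B
      then \<iota> (shuffle_sign A B * shuffle_sign {m} (A \<union> B)) * F (insert m (A \<union> B)) else 0)"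
    by (auto simp: iota(2) mult.assoc)
  show ?case
  proof (cases "A \<inter> B = {} \<and> m \<notin> B")
    case True
    have "{(x, y) \<in> {m} \<times> A. x < y} = {}" using insert.hyps(2) by auto
    then have "shuffle_sign {m} A = 1" unfolding shuffle_sign_def by (metis card.empty power_0)
    then have "shuffle_sign {m} (A \<union> B) = shuffle_sign {m} B"
      using shuffle_sign_union_right[of "{m}" A B] insert.hyps insert.prems True by simp
    moreover have "shuffle_sign (insert m A) B = shuffle_sign {m} B * shuffle_sign A B"
      using shuffle_sign_union_left[of "{m}" A B] insert.hyps insert.prems m by simp
    ultimately show ?thesis using * True by (auto simp: mult.commute)
  next
    case False
    then show ?thesis unfolding * by auto
  qed
qed

lemma ext_universal:
  "\<exists>!D. (\<forall>u v. D (u + v) = D u + D v) \<and> (\<forall>c u. D (scaleQ c u) = \<iota> c * D u) \<and>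
     D 1 = 1 \<and> (\<forall>u v. D (u * v) = D u * D v) \<and> (\<forall>i. D (bas (int i)) = f i)"
proof (rule ex_ex1I)
  define D where "D u = (\<Sum>A | coord u A \<noteq> 0. \<iota> (coord u A) * F A)" for u
  have D: "D u = (\<Sum>A\<in>S. \<iota> (coord u A) * F A)" if "finite S" "{A. coord u A \<noteq> 0} \<subseteq> S" for u S
    unfolding D_def using that by (intro sum.mono_neutral_left) auto
  have add: "D (u + v) = D u + D v" for u v
  proof -
    let ?S = "{A. coord u A \<noteq> 0} \<union> {A. coord v A \<noteq> 0}"
    have "finite ?S" by (simp add: finite_coord)
    then have "D (u + v) = (\<Sum>A\<in>?S. \<iota> (coord (u + v) A) * F A)"
      "D u = (\<Sum>A\<in>?S. \<iota> (coord u A) * F A)" "D v = (\<Sum>A\<in>?S. \<iota> (coord v A) * F A)"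
      by (intro D; auto simp: plus_ext.rep_eq)+
    then show ?thesis by (simp add: plus_ext.rep_eq iota(1) distrib_right sum.distrib)
  qed
  have scale: "D (scaleQ c u) = \<iota> c * D u" for c u
  proof -
    have "D (scaleQ c u) = (\<Sum>A | coord u A \<noteq> 0. \<iota> (coord (scaleQ c u) A) * F A)"
      by (intro D) (auto simp: scaleQ.rep_eq finite_coord)
    then show ?thesis by (simp add: D_def scaleQ.rep_eq iota(2) sum_distrib_left mult.assoc)
  qed
  have monom: "D (monom_ext A) = F A" if "finite A" for A
    using D[of "{A}" "monom_ext A"] that by (auto simp: monom_ext.rep_eq iota(3) split: if_splits)
  have zero: "D 0 = 0" using scale[of 0 0] by (simp add: D_def zero_ext.rep_eq)
  have sum: "D (sum g S) = (\<Sum>x\<in>S. D (g x))" for g :: "nat set \<Rightarrow> ext" and S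
    by (induction S rule: infinite_finite_induct) (simp_all add: zero add)
  have mult_monom: "D (monom_ext A * monom_ext B) = F A * F B" if "finite A" "finite B" for A B
    using that by (simp add: monom_ext_mult scale monom F_mult zero)
  have fin: "finite A" if "coord u A \<noteq> 0" for u A
    using coord_infinite that by blast
  have mult: "D (u * v) = D u * D v" for u v
  proof -
    let ?U = "{A. coord u A \<noteq> 0}" and ?V = "{A. coord v A \<noteq> 0}"
    have "u * v = (\<Sum>A\<in>?U. scaleQ (coord u A) (monom_ext A)) * (\<Sum>B\<in>?V. scaleQ (coord v B) (monom_ext B))"
      using ext_expand by metis
    also have "\<dots> = (\<Sum>A\<in>?U. \<Sum>B\<in>?V. scaleQ (coord v B) (scaleQ (coord u A) (monom_ext A * monom_ext B)))"
      by (simp add: sum_product scaleQ_mult)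
    finally have "D (u * v) = (\<Sum>A\<in>?U. \<Sum>B\<in>?V. \<iota> (coord v B) * (\<iota> (coord u A) * (F A * F B)))"
      by (simp add: sum scale) (intro sum.cong refl, auto simp: mult_monom fin)
    also have "\<dots> = (\<Sum>A\<in>?U. \<Sum>B\<in>?V. \<iota> (coord u A) * F A * (\<iota> (coord v B) * F B))"
      by (intro sum.cong refl) (metis iota(4) mult.assoc)
    also have "\<dots> = D u * D v"
      by (simp add: D_def sum_product)
    finally show ?thesis .
  qed
  have gen: "D (bas (int i)) = f i" for i
    using monom[of "{i}"] F_insert[of "{}" i] by (simp add: bas_def)
  have one: "D 1 = 1"
    using monom[of "{}"] by (simp add: one_ext_monom)
  show "\<exists>D. (\<forall>u v. D (u + v) = D u + D v) \<and> (\<forall>c u. D (scaleQ c u) = \<iota> c * D u) \<and>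
     D 1 = 1 \<and> (\<forall>u v. D (u * v) = D u * D v) \<and> (\<forall>i. D (bas (int i)) = f i)"
    using add scale one mult gen by blast
next
  fix D E
  assume D: "(\<forall>u v. D (u + v) = D u + D v) \<and> (\<forall>c u. D (scaleQ c u) = \<iota> c * D u) \<and>
      D 1 = 1 \<and> (\<forall>u v. D (u * v) = D u * D v) \<and> (\<forall>i. D (bas (int i)) = f i)"
    and E: "(\<forall>u v. E (u + v) = E u + E v) \<and> (\<forall>c u. E (scaleQ c u) = \<iota> c * E u) \<and>
      E 1 = 1 \<and> (\<forall>u v. E (u * v) = E u * E v) \<and> (\<forall>i. E (bas (int i)) = f i)"
  have *: "D (monom_ext A) = E (monom_ext A)" if "finite A" for A
    using that
  proof (induction A rule: finite_linorder_max_induct)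
    case empty
    then show ?case using D E by (simp add: one_ext_monom[symmetric])
  next
    case (insert m A)
    then show ?case using D E by (metis bas_mult_monom_ext)
  qed
  have zero: "D 0 = 0" "E 0 = 0"
    using D E by (metis add_cancel_left_left)+
  have sum: "D (sum g S) = (\<Sum>x\<in>S. D (g x))" "E (sum g S) = (\<Sum>x\<in>S. E (g x))"
    for g :: "nat set \<Rightarrow> ext" and S
    using D E by (induction S rule: infinite_finite_induct) (simp_all add: zero)
  show "D = E"
  proof
    fix u
    have "D (\<Sum>A | coord u A \<noteq> 0. scaleQ (coord u A) (monom_ext A)) =
        E (\<Sum>A | coord u A \<noteq> 0. scaleQ (coord u A) (monom_ext A))"
      unfolding sum using D E by (intro sum.cong) (auto, metis * coord_infinite)
    then show "D u = E u" using ext_expand by metis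
  qed
qed

end

section \<open>The operators $\sigma_+(z)$ and $\overline\sigma_-(z)$\<close>

text \<open>
  $\mathbb{Q}$-linear multiplicative unital maps from the exterior algebra to the Laurent series in
  one variable over it. Both $\sigma_+(z)$ and $\overline\sigma_-(z)$ are maps of this kind; they are
  already unique among these, so their smaller ranges (power series in $z$, polynomials in
  $z^{-1}$) need not be imposed.
\<close>

definition mult_linear :: "(ext \<Rightarrow> ext fls) \<Rightarrow> bool" where
  "mult_linear D \<longleftrightarrow>
    (\<forall>n. Vector_Spaces.linear scaleQ scaleQ (\<lambda>u. fls_nth (D u) n)) \<and>
    D 1 = 1 \<and> (\<forall>u v. D (u * v) = D u * D v)"

text \<open>Existence and uniqueness: \<open>sigma_plus_ex1\<close>, \<open>sigma_minus_ex1\<close>.\<close>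

definition sigma_plus :: "ext \<Rightarrow> ext fls" where
  "sigma_plus = (THE D. mult_linear D \<and>
    (\<forall>j::nat. D (bas (int j)) = fps_to_fls (Abs_fps (\<lambda>i. bas (int j + int i)))))"

definition sigma_minus :: "ext \<Rightarrow> ext fls" where
  "sigma_minus = (THE D. mult_linear D \<and>
    (\<forall>j::nat. D (bas (int j)) = fls_const (bas (int j)) - fls_const (bas (int j - 1)) * fls_X_inv))"

lemma fls_const_scaleQ_nth:
  "fls_nth (fls_const (scaleQ c 1) * G) n = scaleQ c (fls_nth G n)"
  "fls_nth (G * fls_const (scaleQ c 1)) n = scaleQ c (fls_nth G n)"
  by (simp_all add: scaleQ_mult)

lemma mult_linear_iff:
  "mult_linear D \<longleftrightarrow> (\<forall>u v. D (u + v) = D u + D v) \<and>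
    (\<forall>c u. D (scaleQ c u) = fls_const (scaleQ c 1) * D u) \<and>
    D 1 = 1 \<and> (\<forall>u v. D (u * v) = D u * D v)"
  using vector_space_scaleQ
  by (auto simp: mult_linear_def fls_eq_iff fls_const_scaleQ_nth Vector_Spaces.linear_iff
      simp del: fls_mult_const_nth)

lemma mult_linear_ex1:
  assumes "\<And>i j. f i * f j = - (f j * f i)"
  shows "\<exists>!D. mult_linear D \<and> (\<forall>j::nat. D (bas (int j)) = f j)"
proof -
  have sq: "f i * f i = 0" for i
  proof (rule fls_eqI)
    fix n
    have "fls_nth (f i * f i) n = - fls_nth (f i * f i) n"
      by (metis assms fls_uminus_nth)
    then show "fls_nth (f i * f i) n = fls_nth 0 n"
      by (auto intro!: ext_eqI dest: arg_cong[of _ _ coord] simp: uminus_ext.rep_eq zero_ext.rep_eq fun_eq_iff)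
  qed
  interpret vector_space scaleQ by (rule vector_space_scaleQ)
  have "\<exists>!D. (\<forall>u v. D (u + v) = D u + D v) \<and>
      (\<forall>c u. D (scaleQ c u) = fls_const (scaleQ c 1) * D u) \<and>
      D 1 = 1 \<and> (\<forall>u v. D (u * v) = D u * D v) \<and> (\<forall>i. D (bas (int i)) = f i)"
  proof (rule ext_universal)
    show "fls_const (scaleQ (c + d) 1) = fls_const (scaleQ c 1) + fls_const (scaleQ d 1)" for c d
      by (rule fls_eqI) (simp add: scale_left_distrib)
    show "fls_const (scaleQ (c * d) 1) = fls_const (scaleQ c 1) * fls_const (scaleQ d 1)" for c d
      by (simp add: scaleQ_mult mult.commute)
    show "fls_const (scaleQ c 1) * G = G * fls_const (scaleQ c 1)" for c G
      by (rule fls_eqI) (simp only: fls_const_scaleQ_nth)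
    show "fls_const (scaleQ 1 1) = 1"
      by simp
  qed (rule sq, rule assms)
  then show ?thesis by (simp add: mult_linear_iff)
qed

lemma sigma_plus_ex1:
  "\<exists>!D. mult_linear D \<and>
    (\<forall>j::nat. D (bas (int j)) = fps_to_fls (Abs_fps (\<lambda>i. bas (int j + int i))))"
proof (rule mult_linear_ex1)
  fix j l :: nat
  have "Abs_fps (\<lambda>i. bas (int j + int i)) * Abs_fps (\<lambda>i. bas (int l + int i)) =
      - (Abs_fps (\<lambda>i. bas (int l + int i)) * Abs_fps (\<lambda>i. bas (int j + int i)))"
  proof (rule fps_ext)
    fix n
    have "(\<Sum>i=0..n. bas (int j + int i) * bas (int l + int (n - i))) =
        (\<Sum>i=0..n. bas (int j + int (n - i)) * bas (int l + int i))"
      by (rule sum.reindex_bij_witness[where i = "\<lambda>i. n - i" and j = "\<lambda>i. n - i"]) auto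
    also have "\<dots> = - (\<Sum>i=0..n. bas (int l + int i) * bas (int j + int (n - i)))"
      unfolding sum_negf[symmetric] by (intro sum.cong refl bas_relations(2))
    finally show "fps_nth (Abs_fps (\<lambda>i. bas (int j + int i)) * Abs_fps (\<lambda>i. bas (int l + int i))) n =
        fps_nth (- (Abs_fps (\<lambda>i. bas (int l + int i)) * Abs_fps (\<lambda>i. bas (int j + int i)))) n"
      by (simp add: fps_mult_nth)
  qed
  then show "fps_to_fls (Abs_fps (\<lambda>i. bas (int j + int i))) * fps_to_fls (Abs_fps (\<lambda>i. bas (int l + int i))) =
      - (fps_to_fls (Abs_fps (\<lambda>i. bas (int l + int i))) * fps_to_fls (Abs_fps (\<lambda>i. bas (int j + int i))))"
    by (metis fls_times_fps_to_fls fps_to_fls_uminus)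
qed

lemma sigma_minus_ex1:
  "\<exists>!D. mult_linear D \<and>
    (\<forall>j::nat. D (bas (int j)) = fls_const (bas (int j)) - fls_const (bas (int j - 1)) * fls_X_inv)"
proof (rule mult_linear_ex1)
  fix j l :: nat
  let ?X = "fls_X_inv :: ext fls" and ?c = "\<lambda>i. fls_const (bas i)"
  have c: "?c i * ?c i' = - (?c i' * ?c i)" for i i'
    using bas_relations(2)[of i i'] by simp
  have X: "?X * G = G * ?X" for G
    by (simp add: fls_X_inv_times_conv_shift)
  have X1: "?c i * ?X * ?c i' = ?c i * ?c i' * ?X" for i i'
    by (metis X mult.assoc)
  have X2: "?c i * (?c i' * ?X) = ?c i * ?c i' * ?X" for i i'
    by (simp only: mult.assoc)
  have X3: "?c i * ?X * (?c i' * ?X) = ?c i * ?c i' * ?X * ?X" for i i'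
    by (metis X mult.assoc)
  have prod: "(x - y) * (x' - y') = x * x' - x * y' - y * x' + y * y'" for x y x' y' :: "ext fls"
    by (simp add: algebra_simps)
  have neg: "- x - - y - - x' + - y' = - (x - x' - y + y')" for x y x' y' :: "ext fls"
    by simp
  show "(?c (int j) - ?c (int j - 1) * ?X) * (?c (int l) - ?c (int l - 1) * ?X) =
      - ((?c (int l) - ?c (int l - 1) * ?X) * (?c (int j) - ?c (int j - 1) * ?X))"
    unfolding prod X1 X2 X3 c[of "int j" "int l"] c[of "int j" "int l - 1"]
      c[of "int j - 1" "int l"] c[of "int j - 1" "int l - 1"] mult_minus_left neg ..
qed

section \<open>Formal series in several variables\<close>

text \<open>The variables are numbered from 0: $z_{j+1}$ is \<open>Z j\<close> and $w_{j+1}$ is \<open>W j\<close>.\<close>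

datatype var = Z nat | W nat

text \<open>Series with coefficients in the exterior algebra, as functions from the exponents of the
  monomials to the coefficients.\<close>

type_synonym expo = "var \<Rightarrow>\<^sub>0 int"
type_synonym series = "expo \<Rightarrow> ext"

definition const_series :: "ext \<Rightarrow> series" where
  "const_series u = (\<lambda>m. if m = 0 then u else 0)"

definition in_var :: "var \<Rightarrow> ext fls \<Rightarrow> series" where
  "in_var x F = (\<lambda>m. if Poly_Mapping.keys m \<subseteq> {x} then fls_nth F (Poly_Mapping.lookup m x) else 0)"

text \<open>In the next two definitions \<^const>\<open>Sum_any\<close> is the sum over all exponents; in all uses below
  only finitely many summands are non-zero.\<close>

definition wedge_series :: "series \<Rightarrow> series \<Rightarrow> series" where
  "wedge_series f g = (\<lambda>m. Sum_any (\<lambda>p. f p * g (m - p)))"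

text \<open>The coefficientwise extension of an operator, $\sum_p f_p x^p \mapsto \sum_p D(f_p)\, x^p$.\<close>

definition extend :: "(ext \<Rightarrow> series) \<Rightarrow> series \<Rightarrow> series" where
  "extend D f = (\<lambda>m. Sum_any (\<lambda>p. D (f p) (m - p)))"

definition monomial_times :: "expo \<Rightarrow> series \<Rightarrow> series" where
  "monomial_times p f = (\<lambda>m. f (m - p))"

text \<open>$M[[X]][Y^{-1}]$ for $Y \subseteq X$.\<close>

definition series_space :: "ext set \<Rightarrow> var set \<Rightarrow> var set \<Rightarrow> series set" where
  "series_space M X Y = {f. (\<forall>m. f m \<in> M) \<and>
    (\<exists>N::nat. \<forall>m. f m \<noteq> 0 \<longrightarrow> Poly_Mapping.keys m \<subseteq> X \<and>
      (\<forall>x\<in>X. Poly_Mapping.lookup m x \<ge> (if x \<in> Y then - int N else 0)))}"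

text \<open>$\bigwedge^r V$, spanned by the products of \<open>r\<close> elements of $V$.\<close>

definition ext_power :: "nat \<Rightarrow> ext set" where
  "ext_power r = module.span scaleQ
    {prod_list vs | vs. length vs = r \<and> set vs \<subseteq> module.span scaleQ (range bas)}"

section \<open>The vertex operator\<close>

text \<open>$\sigma_+(\mathbf z_k) = \sigma_+(z_1) \cdots \sigma_+(z_k)$ and likewise
  $\overline\sigma_-(\mathbf z_k)$.\<close>

definition sigma_plus_z :: "nat \<Rightarrow> series \<Rightarrow> series" where
  "sigma_plus_z k f = foldr (\<lambda>j. extend (\<lambda>u. in_var (Z j) (sigma_plus u))) [0..<k] f"

definition sigma_minus_z :: "nat \<Rightarrow> series \<Rightarrow> series" where
  "sigma_minus_z k f = foldr (\<lambda>j. extend (\<lambda>u. in_var (Z j) (sigma_minus u))) [0..<k] f"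

text \<open>Partitions of length at most \<open>r\<close>, padded by zeros; \<open>lam i\<close> is the part $\lambda_{i+1}$.\<close>

definition partitions :: "nat \<Rightarrow> (nat \<Rightarrow> nat) set" where
  "partitions r = {lam. antimono lam \<and> (\<forall>i\<ge>r. lam i = 0)}"

definition b_part :: "nat \<Rightarrow> (nat \<Rightarrow> nat) \<Rightarrow> ext" where
  "b_part r lam = prod_list (map (\<lambda>i. bas (int r - 1 - int i + int (lam i))) [0..<r])"

text \<open>The vectors \<open>b_part r lam\<close> are the monomials \<open>monom_ext A\<close>, each of them once.\<close>

definition part_set :: "nat \<Rightarrow> (nat \<Rightarrow> nat) \<Rightarrow> nat set" where
  "part_set r lam = (\<lambda>i. r - 1 - i + lam i) ` {..<r}"

lemma part_set_Suc: "part_set (Suc r) lam = insert (r + lam 0) (part_set r (\<lambda>i. lam (Suc i)))"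
  by (simp add: part_set_def lessThan_Suc_eq_insert_0 image_image)

lemma part_set_less: "lam \<in> partitions (Suc r) \<Longrightarrow> a \<in> part_set r (\<lambda>i. lam (Suc i)) \<Longrightarrow> a < r + lam 0"
proof -
  assume "lam \<in> partitions (Suc r)" and a: "a \<in> part_set r (\<lambda>i. lam (Suc i))"
  then have "antimono lam" by (simp add: partitions_def)
  from a obtain i where "i < r" "a = r - 1 - i + lam (Suc i)" by (auto simp: part_set_def)
  moreover have "lam (Suc i) \<le> lam 0" using antimonoD[OF \<open>antimono lam\<close>] by simp
  ultimately show "a < r + lam 0" by linarith
qed

lemma partitions_Suc: "lam \<in> partitions (Suc r) \<Longrightarrow> (\<lambda>i. lam (Suc i)) \<in> partitions r"
  by (auto simp: partitions_def antimono_def)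

lemma finite_part_set [simp]: "finite (part_set r lam)"
  by (simp add: part_set_def)

lemma b_part_eq_monom: "lam \<in> partitions r \<Longrightarrow> b_part r lam = monom_ext (part_set r lam)"
proof (induction r arbitrary: lam)
  case 0
  then show ?case by (simp add: b_part_def part_set_def one_ext_monom)
next
  case (Suc r)
  have "map (\<lambda>i. bas (int (Suc r) - 1 - int i + int (lam i))) [0..<Suc r] =
      bas (int (r + lam 0)) # map (\<lambda>i. bas (int r - 1 - int i + int (lam (Suc i)))) [0..<r]"
    by (simp only: upt_conv_Cons[of 0 "Suc r"] map_Suc_upt[symmetric] list.map map_map o_def)
      (simp add: upt_conv_Cons[of 0 "Suc r"] map_Suc_upt[symmetric] o_def algebra_simps)
  then have "b_part (Suc r) lam = bas (int (r + lam 0)) * b_part r (\<lambda>i. lam (Suc i))"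
    unfolding b_part_def by (simp only: prod_list.Cons)
  also have "\<dots> = monom_ext (part_set (Suc r) lam)"
    unfolding Suc.IH[OF partitions_Suc[OF Suc.prems]] part_set_Suc
    by (intro bas_mult_monom_ext) (auto intro: part_set_less[OF Suc.prems])
  finally show ?case .
qed

lemma part_set_card: "lam \<in> partitions r \<Longrightarrow> card (part_set r lam) = r"
proof (induction r arbitrary: lam)
  case (Suc r)
  have "r + lam 0 \<notin> part_set r (\<lambda>i. lam (Suc i))"
    using part_set_less[OF Suc.prems] by blast
  then show ?case
    using Suc.IH[OF partitions_Suc[OF Suc.prems]] by (simp add: part_set_Suc)
qed (simp add: part_set_def)

lemma part_set_inj:
  "lam \<in> partitions r \<Longrightarrow> mu \<in> partitions r \<Longrightarrow> part_set r lam = part_set r mu \<Longrightarrow> lam = mu"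
proof (induction r arbitrary: lam mu)
  case 0
  then show ?case by (auto simp: partitions_def)
next
  case (Suc r)
  have Max: "Max (part_set (Suc r) nu) = r + nu 0" if "nu \<in> partitions (Suc r)" for nu
    by (rule Max_eqI) (auto simp: part_set_Suc dest: part_set_less[OF that])
  have 0: "lam 0 = mu 0"
    using Max[OF Suc.prems(1)] Max[OF Suc.prems(2)] Suc.prems(3) by simp
  have del: "part_set r (\<lambda>i. nu (Suc i)) = part_set (Suc r) nu - {r + nu 0}"
    if "nu \<in> partitions (Suc r)" for nu
    by (auto simp: part_set_Suc dest: part_set_less[OF that])
  have "part_set r (\<lambda>i. lam (Suc i)) = part_set r (\<lambda>i. mu (Suc i))"
    unfolding del[OF Suc.prems(1)] del[OF Suc.prems(2)] 0 Suc.prems(3) ..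
  then have "(\<lambda>i. lam (Suc i)) = (\<lambda>i. mu (Suc i))"
    by (intro Suc.IH partitions_Suc Suc.prems)
  then have "lam i = mu i" for i
    using 0 by (cases i) (auto dest: fun_cong)
  then show ?case ..
qed

lemma part_set_surj: "finite A \<Longrightarrow> \<exists>lam \<in> partitions (card A). part_set (card A) lam = A"
proof (induction A rule: finite_linorder_max_induct)
  case empty
  have "(\<lambda>_. 0) \<in> partitions 0" by (simp add: partitions_def antimono_def)
  then show ?case by (auto simp: part_set_def)
next
  case (insert m A)
  then obtain lam where lam: "lam \<in> partitions (card A)" "part_set (card A) lam = A" by blast
  have m: "m \<notin> A" using insert.hyps(2) by blast
  have le: "card A + lam 0 \<le> m"
  proof (cases "card A")
    case 0
    then show ?thesis using lam(1) by (simp add: partitions_def)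
  next
    case (Suc n)
    then have "card A - 1 + lam 0 \<in> A"
      by (subst lam(2)[symmetric]) (auto simp: part_set_def intro: image_eqI[of _ _ 0])
    then show ?thesis using insert.hyps(2) Suc by fastforce
  qed
  define mu where "mu = case_nat (m - card A) lam"
  have mu: "mu 0 = m - card A" "(\<lambda>i. mu (Suc i)) = lam"
    by (auto simp: mu_def)
  have "antimono lam" using lam(1) by (simp add: partitions_def)
  have "antimono mu"
    unfolding antimono_iff_le_Suc
  proof
    fix n
    show "mu (Suc n) \<le> mu n"
    proof (cases n)
      case 0
      then show ?thesis using le by (simp add: mu_def)
    next
      case (Suc n')
      then show ?thesis using antimonoD[OF \<open>antimono lam\<close>, of n' "Suc n'"] by (simp add: mu_def)
    qed
  qed
  moreover have "mu i = 0" if "i \<ge> Suc (card A)" for i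
    using that lam(1) by (cases i) (auto simp: mu_def partitions_def)
  ultimately have "mu \<in> partitions (Suc (card A))" by (simp add: partitions_def)
  moreover have "part_set (Suc (card A)) mu = insert m A"
    using le by (simp add: part_set_Suc mu lam(2))
  ultimately show ?case using insert.hyps(1) m by auto
qed

lemma linear_b_part_ex1:
  fixes g :: "nat \<Rightarrow> (nat \<Rightarrow> nat) \<Rightarrow> series"
  shows "\<exists>!G. (\<forall>m. Vector_Spaces.linear scaleQ scaleQ (\<lambda>u. G u m)) \<and>
    (\<forall>r. \<forall>lam \<in> partitions r. G (b_part r lam) = g r lam)"
proof (rule ex_ex1I)
  interpret vector_space scaleQ by (rule vector_space_scaleQ)
  define part_of where "part_of A = (SOME lam. lam \<in> partitions (card A) \<and> part_set (card A) lam = A)" for A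
  have part_of: "part_of (part_set r lam) = lam" if "lam \<in> partitions r" for r lam
    unfolding part_of_def part_set_card[OF that] using that by (intro some_equality) (auto intro: part_set_inj)
  define h where "h A = g (card A) (part_of A)" for A
  define G where "G u m = (\<Sum>A | coord u A \<noteq> 0. scaleQ (coord u A) (h A m))" for u m
  have G: "G u m = (\<Sum>A\<in>S. scaleQ (coord u A) (h A m))"
    if "finite S" "{A. coord u A \<noteq> 0} \<subseteq> S" for u m S
    unfolding G_def using that by (intro sum.mono_neutral_left) auto
  have "G (u + v) m = G u m + G v m" for u v m
  proof -
    let ?S = "{A. coord u A \<noteq> 0} \<union> {A. coord v A \<noteq> 0}"
    have "finite ?S" by (simp add: finite_coord)
    then have "G (u + v) m = (\<Sum>A\<in>?S. scaleQ (coord (u + v) A) (h A m))"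
      "G u m = (\<Sum>A\<in>?S. scaleQ (coord u A) (h A m))" "G v m = (\<Sum>A\<in>?S. scaleQ (coord v A) (h A m))"
      by (intro G; auto simp: plus_ext.rep_eq)+
    then show ?thesis by (simp add: plus_ext.rep_eq scale_left_distrib sum.distrib)
  qed
  moreover have "G (scaleQ c u) m = scaleQ c (G u m)" for c u m
  proof -
    have "G (scaleQ c u) m = (\<Sum>A | coord u A \<noteq> 0. scaleQ (coord (scaleQ c u) A) (h A m))"
      by (intro G) (auto simp: scaleQ.rep_eq finite_coord)
    then show ?thesis by (simp add: G_def scaleQ.rep_eq scale_sum_right)
  qed
  moreover have "G (b_part r lam) = g r lam" if "lam \<in> partitions r" for r lam
  proof
    fix m
    have "G (b_part r lam) m = (\<Sum>A\<in>{part_set r lam}. scaleQ (coord (b_part r lam) A) (h A m))"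
      by (intro G) (auto simp: b_part_eq_monom[OF that] monom_ext.rep_eq split: if_splits)
    also have "\<dots> = g r lam m"
      by (simp add: b_part_eq_monom[OF that] monom_ext.rep_eq h_def part_set_card[OF that] part_of[OF that])
    finally show "G (b_part r lam) m = g r lam m" .
  qed
  ultimately show "\<exists>G. (\<forall>m. Vector_Spaces.linear scaleQ scaleQ (\<lambda>u. G u m)) \<and>
      (\<forall>r. \<forall>lam \<in> partitions r. G (b_part r lam) = g r lam)"
    by (intro exI[of _ G]) (simp add: Vector_Spaces.linear_iff vector_space_axioms)
next
  fix G H :: "ext \<Rightarrow> series"
  assume "(\<forall>m. Vector_Spaces.linear scaleQ scaleQ (\<lambda>u. G u m)) \<and>
      (\<forall>r. \<forall>lam \<in> partitions r. G (b_part r lam) = g r lam)"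
    and "(\<forall>m. Vector_Spaces.linear scaleQ scaleQ (\<lambda>u. H u m)) \<and>
      (\<forall>r. \<forall>lam \<in> partitions r. H (b_part r lam) = g r lam)"
  then have G: "\<And>m. Vector_Spaces.linear scaleQ scaleQ (\<lambda>u. G u m)"
      "\<And>r lam. lam \<in> partitions r \<Longrightarrow> G (b_part r lam) = g r lam"
    and H: "\<And>m. Vector_Spaces.linear scaleQ scaleQ (\<lambda>u. H u m)"
      "\<And>r lam. lam \<in> partitions r \<Longrightarrow> H (b_part r lam) = g r lam"
    by blast+
  have monom: "G (monom_ext A) = H (monom_ext A)" if fin: "finite A" for A
  proof -
    obtain lam where "lam \<in> partitions (card A)" "part_set (card A) lam = A"
      using part_set_surj[OF fin] by blast
    then show ?thesis using G(2) H(2) b_part_eq_monom by metis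
  qed
  have lin: "K u m = (\<Sum>A | coord u A \<noteq> 0. scaleQ (coord u A) (K (monom_ext A) m))"
    if K: "\<And>m. Vector_Spaces.linear scaleQ scaleQ (\<lambda>u. K u m)" for K :: "ext \<Rightarrow> series" and u m
  proof -
    interpret K: Vector_Spaces.linear scaleQ scaleQ "\<lambda>u. K u m" by (rule K)
    have "K u m = K (\<Sum>A | coord u A \<noteq> 0. scaleQ (coord u A) (monom_ext A)) m"
      using ext_expand[of u] by metis
    then show ?thesis by (simp only: K.sum K.scale)
  qed
  show "G = H"
  proof (intro ext)
    fix u m
    show "G u m = H u m"
      unfolding lin[where K = G and u = u and m = m, OF G(1)] lin[where K = H and u = u and m = m, OF H(1)]
      by (intro sum.cong refl) (auto, metis monom coord_infinite)
  qed
qed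

text \<open>The linear map prescribed on the basis \<open>b_part r lam\<close>; it exists and is unique by
  \<open>linear_b_part_ex1\<close>.\<close>

definition Gamma :: "nat \<Rightarrow> ext \<Rightarrow> series" where
  "Gamma k = (THE G. (\<forall>m. Vector_Spaces.linear scaleQ scaleQ (\<lambda>u. G u m)) \<and>
    (\<forall>r. \<forall>lam \<in> partitions r. G (b_part r lam) =
      sigma_plus_z k (sigma_minus_z k (const_series (b_part (r + k) lam)))))"

end

theory Submission
  imports Defs
begin

text \<open>
  Let $U b_j = b_{j+1}$ on $V$. There $\overline\sigma_-(z)\, U = - z^{-1} (1 - z U)$ and
  $\sigma_+(z) = (1 - z U)^{-1}$, so that $\sigma_+(\mathbf z_k) \overline\sigma_-(\mathbf z_k)$ maps
  $b_{j+k} = U^k b_j$ to $(-1)^k (z_1 \cdots z_k)^{-1} b_j$ for $j \ge 0$. As it is multiplicative, and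
  $\overline\sigma_-$ fixes $[\mathbf b]^k_0$, the factorization of $[\mathbf b]^{r+k}_\lambda$ into its
  first $r$ factors, all of index at least $k$, and $[\mathbf b]^k_0$ gives
  $\Gamma(\mathbf z_k) [\mathbf b]^r_\lambda = (-1)^{kr} (z_1 \cdots z_k)^{-r}\,
  [\mathbf b]^r_\lambda \wedge \sigma_+(\mathbf z_k) [\mathbf b]^k_0$. Moving $[\mathbf b]^r_\lambda$ past a
  factor of degree $k$ cancels the sign.
\<close>

section \<open>Degrees in the exterior algebra\<close>

text \<open>Series are bare functions of the exponent, and \<open>Sum_any\<close> over an infinite
  support is 0. Multiplicativity and cancellation therefore do not pass to coefficientwise
  extensions for free: every interchange of sums needs a finiteness argument. The source of
  finiteness is the degree. On V the operators have exponents at least -c, with c = 0 for sigma_+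
  and c = 1 for sigma_-; by multiplicativity they have exponents at least -c d in degree d, so
  homogeneous series with exponents bounded below stay of this kind. Hence the role of
  \<open>graded\<close> and of \<open>series_space (ext_power d) X X\<close>.

  The second obstacle is that U is not surjective: the relation between sigma_- and U describes
  sigma_- only on the image of U, and b_0 is simply fixed. Each of the k operators uses up one U,
  which is why raising the length by exactly k makes the first r factors accessible.\<close>

interpretation ext_vs: vector_space scaleQ
  by (rule vector_space_scaleQ)

lemma coord_times_nonzeroE:
  assumes "coord (u * v) C \<noteq> 0"
  obtains A where "A \<subseteq> C" "coord u A \<noteq> 0" "coord v (C - A) \<noteq> 0"
  using assms by (auto simp: times_ext.rep_eq elim: sum.not_neutral_contains_not_neutral)

lemma card_support_times:
  assumes "\<And>A. coord u A \<noteq> 0 \<Longrightarrow> card A = r" "\<And>A. coord v A \<noteq> 0 \<Longrightarrow> card A = s"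
    and "coord (u * v) C \<noteq> 0"
  shows "card C = r + s"
proof -
  obtain A where A: "A \<subseteq> C" "coord u A \<noteq> 0" "coord v (C - A) \<noteq> 0"
    using assms(3) by (rule coord_times_nonzeroE)
  then have "finite A" "finite (C - A)" using coord_infinite by blast+
  moreover have "C = A \<union> (C - A)" using A(1) by blast
  ultimately have "card C = card A + card (C - A)"
    by (metis card_Un_disjoint Diff_disjoint)
  then show ?thesis using A assms(1,2) by simp
qed

lemma subspace_card_support: "ext_vs.subspace {u. \<forall>A. coord u A \<noteq> 0 \<longrightarrow> card A = r}"
  by (rule ext_vs.subspaceI)
    (auto simp: zero_ext.rep_eq plus_ext.rep_eq scaleQ.rep_eq, metis add_0)

lemma b_part_in_ext_power: "b_part r lam \<in> ext_power r"
proof -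
  have "set (map (\<lambda>i. bas (int r - 1 - int i + int (lam i))) [0..<r]) \<subseteq> ext_vs.span (range bas)"
    using ext_vs.span_base[OF rangeI, of bas] by auto
  then show ?thesis
    unfolding ext_power_def b_part_def
    by (intro ext_vs.span_base CollectI exI conjI refl) auto
qed

lemma monom_ext_in_ext_power: "finite A \<Longrightarrow> monom_ext A \<in> ext_power (card A)"
  using part_set_surj[of A] b_part_eq_monom b_part_in_ext_power by metis

lemma subspace_ext_power: "ext_vs.subspace (ext_power r)"
  unfolding ext_power_def by (rule ext_vs.subspace_span)

lemmas ext_power_closed [simp] =
  ext_vs.subspace_0[OF subspace_ext_power]
  ext_vs.subspace_add[OF subspace_ext_power]
  ext_vs.subspace_neg[OF subspace_ext_power]
  ext_vs.subspace_diff[OF subspace_ext_power]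
  ext_vs.subspace_scale[OF subspace_ext_power]

text \<open>Replaces the span of r-fold products by a condition on coordinates. Degrees add under
  the wedge product, so r vectors of V only produce sets of r elements; conversely, the monomial of
  such a set is some \<open>b_part r lam\<close>.\<close>

lemma ext_power_iff: "u \<in> ext_power r \<longleftrightarrow> (\<forall>A. coord u A \<noteq> 0 \<longrightarrow> card A = r)"
proof
  let ?H = "\<lambda>r. {u. \<forall>A. coord u A \<noteq> 0 \<longrightarrow> card A = r}"
  have V: "ext_vs.span (range bas) \<subseteq> ?H 1"
    by (rule ext_vs.span_minimal[OF _ subspace_card_support])
      (auto simp: bas_def zero_ext.rep_eq monom_ext.rep_eq split: if_splits)
  have "prod_list vs \<in> ?H (length vs)" if "set vs \<subseteq> ext_vs.span (range bas)" for vs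
    using that
  proof (induction vs)
    case Nil
    then show ?case by (simp add: one_ext.rep_eq)
  next
    case (Cons v vs)
    then show ?case
      using V card_support_times[of v 1 "prod_list vs" "length vs"] by auto
  qed
  then have "ext_power r \<subseteq> ?H r"
    unfolding ext_power_def by (intro ext_vs.span_minimal subspace_card_support) auto
  then show "u \<in> ext_power r \<Longrightarrow> \<forall>A. coord u A \<noteq> 0 \<longrightarrow> card A = r"
    by blast
next
  assume u: "\<forall>A. coord u A \<noteq> 0 \<longrightarrow> card A = r"
  have "(\<Sum>A | coord u A \<noteq> 0. scaleQ (coord u A) (monom_ext A)) \<in> ext_power r"
    using u monom_ext_in_ext_power coord_infinite
    by (intro ext_vs.subspace_sum[OF subspace_ext_power] ext_power_closed) blast
  then show "u \<in> ext_power r" using ext_expand[of u] by simp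
qed

lemma one_in_ext_power: "1 \<in> ext_power 0"
  by (simp add: ext_power_iff one_ext.rep_eq)

lemma bas_in_ext_power: "bas i \<in> ext_power 1"
  by (auto simp: ext_power_iff bas_def zero_ext.rep_eq monom_ext.rep_eq split: if_splits)

lemma ext_power_times: "u \<in> ext_power r \<Longrightarrow> v \<in> ext_power s \<Longrightarrow> u * v \<in> ext_power (r + s)"
  by (auto simp: ext_power_iff intro: card_support_times)

text \<open>As A and B are disjoint, each pair in the product is counted by exactly one of the two
  signs, so the two exponents add up to \<open>card A * card B\<close>.\<close>

lemma shuffle_sign_swap:
  assumes "finite A" "finite B" "A \<inter> B = {}"
  shows "shuffle_sign B A = (- 1) ^ (card A * card B) * shuffle_sign A B"
proof -
  let ?L = "{(a, b) \<in> A \<times> B. a < b}" and ?G = "{(a, b) \<in> A \<times> B. b < a}"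
  have "a < b \<or> b < a" if "a \<in> A" "b \<in> B" for a b
    using that assms(3) by (cases a b rule: linorder_cases) auto
  then have AB: "A \<times> B = ?L \<union> ?G" "?L \<inter> ?G = {}" by auto
  have fin: "finite ?L" "finite ?G"
    using assms by (auto intro: finite_subset[of _ "A \<times> B"])
  have "card A * card B = card ?L + card ?G"
    unfolding card_Un_disjoint[OF fin AB(2), symmetric] AB(1)[symmetric]
    by (simp add: card_cartesian_product)
  moreover have "{(b, a) \<in> B \<times> A. b < a} = prod.swap ` ?G" by force
  then have "card {(b, a) \<in> B \<times> A. b < a} = card ?G" by (simp add: card_image)
  ultimately show ?thesis
    by (simp add: shuffle_sign_def power_add)
qed

text \<open>Replacing A by its complement in C matches the terms of both coordinates up to the swap
  sign, and this sign is the same for all nonzero terms because u and v are homogeneous.\<close>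

lemma ext_power_commute:
  assumes "u \<in> ext_power r" "v \<in> ext_power s"
  shows "v * u = scaleQ ((- 1) ^ (r * s)) (u * v)"
proof (rule ext_eqI)
  fix C
  show "coord (v * u) C = coord (scaleQ ((- 1) ^ (r * s)) (u * v)) C"
  proof (cases "finite C")
    case True
    have "coord (v * u) C = (\<Sum>A\<in>Pow C. shuffle_sign (C - A) (C - (C - A)) * coord v (C - A) * coord u (C - (C - A)))"
      unfolding times_ext.rep_eq
      by (rule sum.reindex_bij_witness[where i = "\<lambda>A. C - A" and j = "\<lambda>A. C - A"])
        (auto simp: double_diff)
    also have "\<dots> = (\<Sum>A\<in>Pow C. (- 1) ^ (r * s) * (shuffle_sign A (C - A) * coord u A * coord v (C - A)))"
    proof (rule sum.cong[OF refl])
      fix A assume "A \<in> Pow C"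
      then have A: "C - (C - A) = A" "finite A" "finite (C - A)" using True by (auto intro: finite_subset)
      show "shuffle_sign (C - A) (C - (C - A)) * coord v (C - A) * coord u (C - (C - A)) =
          (- 1) ^ (r * s) * (shuffle_sign A (C - A) * coord u A * coord v (C - A))"
      proof (cases "coord u A = 0 \<or> coord v (C - A) = 0")
        case False
        then have "card A = r" "card (C - A) = s" using assms by (auto simp: ext_power_iff)
        then show ?thesis using shuffle_sign_swap[of A "C - A"] A by simp
      qed (auto simp: A)
    qed
    also have "\<dots> = coord (scaleQ ((- 1) ^ (r * s)) (u * v)) C"
      by (simp add: scaleQ.rep_eq times_ext.rep_eq sum_distrib_left)
    finally show ?thesis .
  qed (simp add: coord_infinite)
qed

text \<open>Here c bounds the order of the pole that one factor from V can contribute; d factors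
  contribute at most c d. The bound is what later makes sums over exponents finite.\<close>

definition graded :: "(ext \<Rightarrow> ext fls) \<Rightarrow> nat \<Rightarrow> bool" where
  "graded S c \<longleftrightarrow> mult_linear S \<and> (\<forall>d. \<forall>u\<in>ext_power d. \<forall>n. fls_nth (S u) n \<in> ext_power d \<and>
    (fls_nth (S u) n \<noteq> 0 \<longrightarrow> - int (c * d) \<le> n))"

lemma mult_linear_linear:
  assumes "mult_linear S"
  shows "Vector_Spaces.linear scaleQ scaleQ (\<lambda>u. fls_nth (S u) n)"
  using assms by (simp add: mult_linear_def)

lemma ext_mult_nonzeroD: "(u :: ext) * v \<noteq> 0 \<Longrightarrow> u \<noteq> 0 \<and> v \<noteq> 0"
  by auto

lemma fls_times_nonzeroE:
  fixes F G :: "ext fls"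
  assumes "fls_nth (F * G) n \<noteq> 0"
  obtains i where "fls_nth F i \<noteq> 0" "fls_nth G (n - i) \<noteq> 0"
proof -
  have "(\<Sum>i = fls_subdegree F..n - fls_subdegree G. fls_nth F i * fls_nth G (n - i)) \<noteq> 0"
    using assms by (simp only: fls_times_nth(2)[symmetric] not_False_eq_True)
  then obtain i where "fls_nth F i * fls_nth G (n - i) \<noteq> 0"
    by (rule sum.not_neutral_contains_not_neutral)
  then show thesis using that[of i] ext_mult_nonzeroD by blast
qed

text \<open>A check on the generators suffices: multiplicativity carries both properties to
  monomials, splitting off the largest index, and linearity carries them to all of degree d.\<close>

lemma gradedI:
  assumes S: "mult_linear S"
    and V: "\<And>j n. fls_nth (S (bas (int j))) n \<in> ext_power 1"
    and low: "\<And>j n. fls_nth (S (bas (int j))) n \<noteq> 0 \<Longrightarrow> - int c \<le> n"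
  shows "graded S c"
proof -
  have monom: "fls_nth (S (monom_ext A)) n \<in> ext_power (card A) \<and>
      (fls_nth (S (monom_ext A)) n \<noteq> 0 \<longrightarrow> - int (c * card A) \<le> n)" if "finite A" for A n
    using that
  proof (induction A arbitrary: n rule: finite_linorder_max_induct)
    case empty
    then show ?case
      using S one_in_ext_power by (auto simp: mult_linear_def one_ext_monom[symmetric])
  next
    case (insert m A)
    have m: "m \<notin> A" using insert.hyps by blast
    have eq: "S (monom_ext (insert m A)) = S (bas (int m)) * S (monom_ext A)"
      using S bas_mult_monom_ext[OF insert.hyps] by (metis mult_linear_def)
    have "fls_nth (S (monom_ext (insert m A))) n \<in> ext_power (1 + card A)"
      unfolding eq fls_times_nth(2)
      by (intro ext_vs.subspace_sum[OF subspace_ext_power] ext_power_times V conjunct1[OF insert.IH])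
    moreover have "- int (c * Suc (card A)) \<le> n" if nz: "fls_nth (S (monom_ext (insert m A))) n \<noteq> 0"
    proof -
      obtain i where "fls_nth (S (bas (int m))) i \<noteq> 0" "fls_nth (S (monom_ext A)) (n - i) \<noteq> 0"
        using nz unfolding eq by (rule fls_times_nonzeroE)
      then have "- int c \<le> i" "- int (c * card A) \<le> n - i" using low insert.IH by blast+
      then show ?thesis by simp
    qed
    ultimately show ?case using insert.hyps m by simp
  qed
  have "fls_nth (S u) n \<in> ext_power d \<and> (fls_nth (S u) n \<noteq> 0 \<longrightarrow> - int (c * d) \<le> n)"
    if u: "u \<in> ext_power d" for d u n
  proof -
    interpret L: Vector_Spaces.linear scaleQ scaleQ "\<lambda>u. fls_nth (S u) n"
      by (rule mult_linear_linear[OF S])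
    have "fls_nth (S u) n = fls_nth (S (\<Sum>A | coord u A \<noteq> 0. scaleQ (coord u A) (monom_ext A))) n"
      using ext_expand[of u] by simp
    also have "\<dots> = (\<Sum>A | coord u A \<noteq> 0. scaleQ (coord u A) (fls_nth (S (monom_ext A)) n))"
      by (simp only: L.sum L.scale)
    finally have eq: "fls_nth (S u) n = (\<Sum>A | coord u A \<noteq> 0. scaleQ (coord u A) (fls_nth (S (monom_ext A)) n))" .
    have A: "finite A \<and> card A = d" if "coord u A \<noteq> 0" for A
      using that u coord_infinite by (auto simp: ext_power_iff)
    have "fls_nth (S u) n \<in> ext_power d"
      unfolding eq using A monom
      by (intro ext_vs.subspace_sum[OF subspace_ext_power] ext_power_closed) blast
    moreover have "- int (c * d) \<le> n" if "fls_nth (S u) n \<noteq> 0"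
    proof -
      obtain B where "coord u B \<noteq> 0" "fls_nth (S (monom_ext B)) n \<noteq> 0"
        using \<open>fls_nth (S u) n \<noteq> 0\<close> unfolding eq
        by (auto elim!: sum.not_neutral_contains_not_neutral)
      then show ?thesis using A monom by blast
    qed
    ultimately show ?thesis by blast
  qed
  with S show ?thesis by (simp add: graded_def)
qed

lemma sigma_plus: "mult_linear sigma_plus"
    "sigma_plus (bas (int j)) = fps_to_fls (Abs_fps (\<lambda>i. bas (int j + int i)))"
  using theI'[OF sigma_plus_ex1] unfolding sigma_plus_def by blast+

lemma sigma_minus: "mult_linear sigma_minus"
    "sigma_minus (bas (int j)) = fls_const (bas (int j)) - fls_const (bas (int j - 1)) * fls_X_inv"
  using theI'[OF sigma_minus_ex1] unfolding sigma_minus_def by blast+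

lemma sigma_plus_bas_nth:
  "fls_nth (sigma_plus (bas (int j))) n = (if n < 0 then 0 else bas (int j + n))"
  by (simp add: sigma_plus)

lemma sigma_minus_bas_nth:
  "fls_nth (sigma_minus (bas (int j))) n =
    (if n = 0 then bas (int j) else if n = - 1 then - bas (int j - 1) else 0)"
  by (simp add: sigma_minus fls_X_inv_times_conv_shift fls_const_nth)

lemma graded_sigma_plus: "graded sigma_plus 0"
  by (rule gradedI) (auto simp: sigma_plus(1) sigma_plus_bas_nth bas_in_ext_power split: if_splits
    simp del: One_nat_def)

lemma graded_sigma_minus: "graded sigma_minus 1"
  by (rule gradedI) (auto simp: sigma_minus(1) sigma_minus_bas_nth bas_in_ext_power split: if_splits
    simp del: One_nat_def)

section \<open>Coefficientwise operators\<close>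

lemma Sum_any_reindex:
  assumes "inj h" "\<And>a. g a \<noteq> 0 \<Longrightarrow> a \<in> range h"
  shows "Sum_any g = Sum_any (\<lambda>b. g (h b))"
proof -
  have "{a. g a \<noteq> 0} = h ` {b. g (h b) \<noteq> 0}"
    using assms(2) by auto
  moreover have "inj_on h {b. g (h b) \<noteq> 0}"
    using assms(1) by (rule inj_on_subset) simp
  ultimately show ?thesis
    by (simp add: Sum_any.expand_set sum.reindex)
qed

lemma Sum_any_nested:
  assumes "finite {(a, b). g a b \<noteq> 0}"
  shows "(SUM a. SUM b. g a b) = (SUM (a, b). g a b)"
proof (rule Sum_any.cartesian_product)
  let ?T = "{(a, b). g a b \<noteq> 0}"
  show "finite (fst ` ?T \<times> snd ` ?T)" using assms by blast
  show "{a. \<exists>b. g a b \<noteq> 0} \<times> {b. \<exists>a. g a b \<noteq> 0} \<subseteq> fst ` ?T \<times> snd ` ?T" by force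
qed

lemma Sum_any_nested3:
  assumes fin: "finite {(a, b, c). g a b c \<noteq> 0}"
  shows "(SUM a. SUM b. SUM c. g a b c) = (SUM (a, b, c). g a b c)"
proof -
  have "finite {(b, c). g a b c \<noteq> 0}" for a
    by (rule finite_subset[OF _ finite_imageI[OF fin, of snd]]) force
  then have "(SUM a. SUM b. SUM c. g a b c) = (SUM a. SUM (b, c). g a b c)"
    by (simp add: Sum_any_nested)
  also have "\<dots> = (SUM (a, bc). case bc of (b, c) \<Rightarrow> g a b c)"
    by (rule Sum_any_nested) (rule finite_subset[OF _ fin], auto)
  finally show ?thesis .
qed

text \<open>Puts the Laurent product in the form of the sums over exponents, so that in
  \<open>apply_in_wedge_series\<close> all of them can be merged into one.\<close>

lemma fls_times_nth_Sum_any: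
  fixes F G :: "ext fls"
  shows "fls_nth (F * G) n = (SUM i. fls_nth F i * fls_nth G (n - i))"
proof -
  have "{i. fls_nth F i * fls_nth G (n - i) \<noteq> 0} \<subseteq> {fls_subdegree F..n - fls_subdegree G}"
  proof
    fix i assume "i \<in> {i. fls_nth F i * fls_nth G (n - i) \<noteq> 0}"
    then have "fls_nth F i \<noteq> 0" "fls_nth G (n - i) \<noteq> 0" by (auto dest: ext_mult_nonzeroD)
    then have "fls_subdegree F \<le> i" "fls_subdegree G \<le> n - i" by (auto intro: fls_subdegree_leI)
    then show "i \<in> {fls_subdegree F..n - fls_subdegree G}" by simp
  qed
  then have "(SUM i. fls_nth F i * fls_nth G (n - i)) =
      (\<Sum>i = fls_subdegree F..n - fls_subdegree G. fls_nth F i * fls_nth G (n - i))"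
    by (rule Sum_any.expand_superset[rotated]) simp
  then show ?thesis by (simp only: fls_times_nth(2))
qed

lemma mult_linear_zero: "mult_linear S \<Longrightarrow> S 0 = 0"
  unfolding mult_linear_iff by (metis add_cancel_left_left)

lemma mult_linear_Sum_any:
  assumes S: "mult_linear S" and fin: "finite {p. g p \<noteq> 0}"
  shows "fls_nth (S (Sum_any g)) n = (SUM p. fls_nth (S (g p)) n)"
proof -
  interpret L: Vector_Spaces.linear scaleQ scaleQ "\<lambda>u. fls_nth (S u) n"
    by (rule mult_linear_linear[OF S])
  have "fls_nth (S (Sum_any g)) n = (\<Sum>p\<in>{p. g p \<noteq> 0}. fls_nth (S (g p)) n)"
    by (simp only: Sum_any.expand_set L.sum)
  also have "\<dots> = (SUM p. fls_nth (S (g p)) n)"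
    by (rule Sum_any.expand_superset[OF fin, symmetric]) (auto simp: mult_linear_zero[OF S])
  finally show ?thesis .
qed

text \<open>The common building block of \<open>sigma_plus_z\<close> and
  \<open>sigma_minus_z\<close>, with the operator S as a parameter so that both are treated at
  once.\<close>

definition apply_in :: "var \<Rightarrow> (ext \<Rightarrow> ext fls) \<Rightarrow> series \<Rightarrow> series" where
  "apply_in x S = extend (\<lambda>u. in_var x (S u))"

lemma keys_subset_single_iff:
  fixes p :: expo
  shows "Poly_Mapping.keys p \<subseteq> {x} \<longleftrightarrow> p = Poly_Mapping.single x (Poly_Mapping.lookup p x)"
proof
  assume "Poly_Mapping.keys p \<subseteq> {x}"
  then show "p = Poly_Mapping.single x (Poly_Mapping.lookup p x)"
    by (intro poly_mapping_eqI) (auto simp: lookup_single when_def in_keys_iff subset_iff)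
next
  assume "p = Poly_Mapping.single x (Poly_Mapping.lookup p x)"
  then show "Poly_Mapping.keys p \<subseteq> {x}" by (metis keys_single empty_subsetI order_refl)
qed

text \<open>Only exponents that differ from m in x alone contribute, so the sum over all exponents
  collapses to a sum over the integers n.\<close>

lemma apply_in_nth:
  "apply_in x S f m = (SUM n. fls_nth (S (f (m - Poly_Mapping.single x n))) n)"
proof -
  let ?g = "\<lambda>p. in_var x (S (f p)) (m - p)"
  have "inj (\<lambda>n::int. m - Poly_Mapping.single x n)"
  proof (rule injI)
    fix n n' :: int
    assume "m - Poly_Mapping.single x n = m - Poly_Mapping.single x n'"
    then have "Poly_Mapping.single x n = Poly_Mapping.single x n'" by simp
    then show "n = n'" by (metis lookup_single_eq)
  qed
  moreover have "p \<in> range (\<lambda>n::int. m - Poly_Mapping.single x n)" if "?g p \<noteq> 0" for p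
  proof -
    have "Poly_Mapping.keys (m - p) \<subseteq> {x}" using that by (simp add: in_var_def split: if_splits)
    then have "m - p = Poly_Mapping.single x (Poly_Mapping.lookup (m - p) x)"
      by (simp only: keys_subset_single_iff)
    then have "p = m - Poly_Mapping.single x (Poly_Mapping.lookup (m - p) x)"
      by (simp add: algebra_simps)
    then show ?thesis by blast
  qed
  ultimately have "Sum_any ?g = (SUM n. ?g (m - Poly_Mapping.single x n))"
    by (rule Sum_any_reindex)
  moreover have "?g (m - Poly_Mapping.single x n) = fls_nth (S (f (m - Poly_Mapping.single x n))) n" for n :: int
    by (auto simp: in_var_def)
  ultimately show ?thesis by (simp add: apply_in_def extend_def)
qed

section \<open>Bounds on exponents and multiplicativity of coefficientwise operators\<close>

lemma finite_expo_box:
  assumes "finite X"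
  shows "finite {p :: expo. Poly_Mapping.keys p \<subseteq> X \<and> (\<forall>y\<in>X. Poly_Mapping.lookup p y \<in> {a..b})}"
proof (rule finite_imageD)
  let ?B = "{p :: expo. Poly_Mapping.keys p \<subseteq> X \<and> (\<forall>y\<in>X. Poly_Mapping.lookup p y \<in> {a..b})}"
  have "Poly_Mapping.lookup ` ?B \<subseteq> {h. \<forall>y. (y \<in> X \<longrightarrow> h y \<in> {a..b}) \<and> (y \<notin> X \<longrightarrow> h y = 0)}"
    by (auto simp: in_keys_iff subset_iff)
  then show "finite (Poly_Mapping.lookup ` ?B)"
    by (rule finite_subset) (intro finite_set_of_finite_funs assms finite_atLeastAtMost_int)
  show "inj_on Poly_Mapping.lookup ?B" by (simp add: inj_on_def lookup_inject)
qed

lemma lookup_bounded: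
  fixes m :: expo
  obtains K where "\<And>y. \<bar>Poly_Mapping.lookup m y\<bar> \<le> K" "0 \<le> K"
proof -
  have "\<bar>Poly_Mapping.lookup m y\<bar> \<le> (\<Sum>y\<in>Poly_Mapping.keys m. \<bar>Poly_Mapping.lookup m y\<bar>)" for y
  proof (cases "y \<in> Poly_Mapping.keys m")
    case True
    then show ?thesis by (intro member_le_sum) auto
  qed (simp add: in_keys_iff sum_nonneg)
  then show thesis by (rule that) (simp add: sum_nonneg)
qed

lemma series_spaceE:
  assumes "f \<in> series_space M X Y"
  obtains N where "\<And>m. f m \<noteq> 0 \<Longrightarrow> Poly_Mapping.keys m \<subseteq> X"
    "\<And>m x. f m \<noteq> 0 \<Longrightarrow> x \<in> X \<Longrightarrow> Poly_Mapping.lookup m x \<ge> (if x \<in> Y then - int N else 0)"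
proof -
  from assms obtain N where "\<forall>m. f m \<noteq> 0 \<longrightarrow> Poly_Mapping.keys m \<subseteq> X \<and>
      (\<forall>x\<in>X. Poly_Mapping.lookup m x \<ge> (if x \<in> Y then - int N else 0))"
    unfolding series_space_def by blast
  then show thesis by (intro that[of N]) blast+
qed

lemma series_spaceI:
  assumes "\<And>m. f m \<in> M" "\<And>m. f m \<noteq> 0 \<Longrightarrow> Poly_Mapping.keys m \<subseteq> X \<and>
      (\<forall>x\<in>X. Poly_Mapping.lookup m x \<ge> (if x \<in> Y then - int N else 0))"
  shows "f \<in> series_space M X Y"
  unfolding series_space_def using assms by blast

lemma series_space_nth: "f \<in> series_space M X Y \<Longrightarrow> f m \<in> M"
  by (simp add: series_space_def)

lemma ext_power_Sum_any: "(\<And>a. g a \<in> ext_power d) \<Longrightarrow> Sum_any g \<in> ext_power d"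
  unfolding Sum_any.expand_set by (rule ext_vs.subspace_sum[OF subspace_ext_power]) auto

lemma Sum_any_nonzeroE:
  assumes "Sum_any g \<noteq> 0"
  obtains a where "g a \<noteq> 0"
  using assms by (rule Sum_any.not_neutral_obtains_not_neutral)

text \<open>S moves the exponent of x by some n at least -c d and leaves the other variables alone,
  so the pole bound grows by at most c d. For c = 0 no pole arises, whence the alternative to
  \<open>x \<in> Y\<close>: it lets sigma_+ act in a variable without negative powers.\<close>

lemma apply_in_series_space:
  assumes S: "graded S c" and f: "f \<in> series_space (ext_power d) X Y"
    and x: "x \<in> X" "x \<in> Y \<or> c = 0"
  shows "apply_in x S f \<in> series_space (ext_power d) X Y"
proof -
  obtain N where N: "\<And>m. f m \<noteq> 0 \<Longrightarrow> Poly_Mapping.keys m \<subseteq> X"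
    "\<And>m x. f m \<noteq> 0 \<Longrightarrow> x \<in> X \<Longrightarrow> Poly_Mapping.lookup m x \<ge> (if x \<in> Y then - int N else 0)"
    using f by (rule series_spaceE) blast
  have "apply_in x S f m \<in> ext_power d" for m
    unfolding apply_in_nth using S f
    by (intro ext_power_Sum_any) (auto simp: graded_def series_space_def)
  moreover have "Poly_Mapping.keys m \<subseteq> X \<and>
      (\<forall>y\<in>X. Poly_Mapping.lookup m y \<ge> (if y \<in> Y then - int (N + c * d) else 0))"
    if nz: "apply_in x S f m \<noteq> 0" for m
  proof -
    obtain n where n: "fls_nth (S (f (m - Poly_Mapping.single x n))) n \<noteq> 0"
      using nz unfolding apply_in_nth by (rule Sum_any_nonzeroE)
    then have "f (m - Poly_Mapping.single x n) \<noteq> 0"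
      using S by (auto simp: graded_def mult_linear_zero)
    note N' = N[OF this]
    have "- int (c * d) \<le> n"
      using n S f by (auto simp: graded_def series_space_def)
    moreover have "Poly_Mapping.keys m \<subseteq> X"
      using N'(1) x(1) by (auto simp: in_keys_iff lookup_minus lookup_single when_def subset_iff split: if_splits)
    moreover have "Poly_Mapping.lookup m y \<ge> (if y \<in> Y then - int (N + c * d) else 0)" if "y \<in> X" for y
    proof -
      have "Poly_Mapping.lookup m y = Poly_Mapping.lookup (m - Poly_Mapping.single x n) y + (if y = x then n else 0)"
        by (simp add: lookup_minus lookup_single when_def)
      moreover have "0 \<le> int (c * d)" "int (N + c * d) = int N + int (c * d)" by simp_all
      moreover have "x \<notin> Y \<Longrightarrow> int (c * d) = 0" using x by simp
      ultimately show ?thesis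
        using N'(2)[OF that] \<open>- int (c * d) \<le> n\<close> by (auto simp del: of_nat_mult of_nat_add split: if_splits)
    qed
    ultimately show ?thesis by blast
  qed
  ultimately show ?thesis by (rule series_spaceI)
qed

lemma keys_subset_Un_diff:
  fixes m p :: expo
  shows "Poly_Mapping.keys m \<subseteq> Poly_Mapping.keys p \<union> Poly_Mapping.keys (m - p)"
  using keys_add[of p "m - p"] by simp

text \<open>Both sides are the sum of one function h over triples (i, j, p): p is the exponent taken
  from f, and i, j are the powers of x that S produces from the coefficients of f and of g. The
  exponent taken from g is then determined by m. The work lies in showing that h has finite
  support.\<close>

lemma apply_in_wedge_series:
  assumes S: "graded S c" and X: "finite X" "x \<in> X"
    and f: "f \<in> series_space (ext_power d) X X" and g: "g \<in> series_space (ext_power e) X X"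
  shows "apply_in x S (wedge_series f g) = wedge_series (apply_in x S f) (apply_in x S g)"
proof
  fix m :: expo
  let ?x = "Poly_Mapping.single x :: int \<Rightarrow> expo"
  note mult_linear = S[unfolded graded_def, THEN conjunct1]
  have S0: "S 0 = 0" using mult_linear by (rule mult_linear_zero)
  obtain N where N: "\<And>m. f m \<noteq> 0 \<Longrightarrow> Poly_Mapping.keys m \<subseteq> X"
    "\<And>m x. f m \<noteq> 0 \<Longrightarrow> x \<in> X \<Longrightarrow> Poly_Mapping.lookup m x \<ge> (if x \<in> X then - int N else 0)"
    using f by (rule series_spaceE) blast
  obtain N' where N': "\<And>m. g m \<noteq> 0 \<Longrightarrow> Poly_Mapping.keys m \<subseteq> X"
    "\<And>m x. g m \<noteq> 0 \<Longrightarrow> x \<in> X \<Longrightarrow> Poly_Mapping.lookup m x \<ge> (if x \<in> X then - int N' else 0)"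
    using g by (rule series_spaceE) blast
  obtain K where K: "\<And>y. \<bar>Poly_Mapping.lookup m y\<bar> \<le> K" "0 \<le> K"
    using lookup_bounded[of m] by blast
  define a where "a p i = fls_nth (S (f p)) i" for p i
  define b where "b p i = fls_nth (S (g p)) i" for p i
  define M where "M = c * d"
  define M' where "M' = c * e"
  have a: "f p \<noteq> 0" "- int M \<le> i" if "a p i \<noteq> 0" for p i
    using that S f S0 by (auto simp: M_def a_def graded_def series_space_def)
  have b: "g p \<noteq> 0" "- int M' \<le> i" if "b p i \<noteq> 0" for p i
    using that S g S0 by (auto simp: M'_def b_def graded_def series_space_def)
  \<comment> \<open>For each variable, the exponents from f and g, together with i and j in the case
    of x, add up to the exponent in m, which is at most K. Each summand has one of the lower bounds
    -N, -N', -M, -M', so each is also bounded above, and B dominates all these bounds.\<close>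
  define B where "B = K + int N + int N' + int M + int M'"
  define h where "h = (\<lambda>(i, j, p). a p i * b (m - p - ?x (i + j)) j)"
  define C where "C = {- B..B} \<times> {- B..B} \<times>
    {p :: expo. Poly_Mapping.keys p \<subseteq> X \<and> (\<forall>y\<in>X. Poly_Mapping.lookup p y \<in> {- B..B})}"
  have "finite C" unfolding C_def using X by (intro finite_cartesian_product finite_expo_box) auto
  have in_C: "t \<in> C" if nz: "h t \<noteq> 0" for t
  proof -
    obtain i j p where t: "t = (i, j, p)" by (cases t)
    have nz: "a p i \<noteq> 0" "b (m - p - ?x (i + j)) j \<noteq> 0"
      using nz unfolding t h_def by (auto dest: ext_mult_nonzeroD)
    have lo: "- int M \<le> i" "- int M' \<le> j" using a(2) b(2) nz by blast+
    have p: "- int N \<le> Poly_Mapping.lookup p y" if "y \<in> X" for y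
      using N(2)[OF a(1)[OF nz(1)] that] that by simp
    have q: "Poly_Mapping.lookup p y + (if y = x then i + j else 0) \<le> K + int N'" if "y \<in> X" for y
      using N'(2)[OF b(1)[OF nz(2)] that] that K(1)[of y]
      by (auto simp: lookup_minus lookup_single when_def split: if_splits)
    have "i \<in> {- B..B}" "j \<in> {- B..B}"
      using lo p[OF X(2)] q[OF X(2)] K(2) unfolding B_def by auto
    moreover have "Poly_Mapping.lookup p y \<in> {- B..B}" if "y \<in> X" for y
      using lo p[OF that] q[OF that] K(2) unfolding B_def by (auto split: if_splits)
    ultimately show ?thesis
      using N(1)[OF a(1)[OF nz(1)]] by (simp add: C_def t)
  qed
  have fin: "finite {t. h t \<noteq> 0}"
    by (rule finite_subset[OF _ \<open>finite C\<close>]) (use in_C in blast)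
  \<comment> \<open>Three more finiteness facts: \<open>fin_inner\<close> allows S to be pulled
    through the sum defining the wedge product, while \<open>fin_a\<close> and \<open>fin_b\<close>
    allow the two sums on the other side to be multiplied out.\<close>
  have fin_inner: "finite {p. f p * g (q - p) \<noteq> 0}" for q :: expo
  proof -
    obtain K where K: "\<And>y. \<bar>Poly_Mapping.lookup q y\<bar> \<le> K" "0 \<le> K"
      using lookup_bounded[of q] by blast
    have "{p. f p * g (q - p) \<noteq> 0} \<subseteq> {p. Poly_Mapping.keys p \<subseteq> X \<and>
        (\<forall>y\<in>X. Poly_Mapping.lookup p y \<in> {- int N..K + int N'})}"
    proof
      fix p assume "p \<in> {p. f p * g (q - p) \<noteq> 0}"
      then have p: "f p \<noteq> 0" "g (q - p) \<noteq> 0" by (auto dest: ext_mult_nonzeroD)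
      have "Poly_Mapping.lookup p y \<in> {- int N..K + int N'}" if "y \<in> X" for y
        using N(2)[OF p(1) that] N'(2)[OF p(2) that] that K(1)[of y] by (auto simp: lookup_minus)
      then show "p \<in> {p. Poly_Mapping.keys p \<subseteq> X \<and>
          (\<forall>y\<in>X. Poly_Mapping.lookup p y \<in> {- int N..K + int N'})}"
        using N(1)[OF p(1)] by blast
    qed
    then show ?thesis by (rule finite_subset) (rule finite_expo_box[OF X(1)])
  qed
  have fin_a: "finite {i. a (q - ?x i) i \<noteq> 0}" for q
  proof (rule finite_subset[of _ "{- int M..Poly_Mapping.lookup q x + int N}"])
    show "{i. a (q - ?x i) i \<noteq> 0} \<subseteq> {- int M..Poly_Mapping.lookup q x + int N}"
    proof
      fix i assume "i \<in> {i. a (q - ?x i) i \<noteq> 0}"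
      then have nz: "a (q - ?x i) i \<noteq> 0" by simp
      show "i \<in> {- int M..Poly_Mapping.lookup q x + int N}"
        using a(2)[OF nz] N(2)[OF a(1)[OF nz] X(2)] X(2) by (simp add: lookup_minus)
    qed
  qed simp
  have fin_b: "finite {i. b (q - ?x i) i \<noteq> 0}" for q
  proof (rule finite_subset[of _ "{- int M'..Poly_Mapping.lookup q x + int N'}"])
    show "{i. b (q - ?x i) i \<noteq> 0} \<subseteq> {- int M'..Poly_Mapping.lookup q x + int N'}"
    proof
      fix i assume "i \<in> {i. b (q - ?x i) i \<noteq> 0}"
      then have nz: "b (q - ?x i) i \<noteq> 0" by simp
      show "i \<in> {- int M'..Poly_Mapping.lookup q x + int N'}"
        using b(2)[OF nz] N'(2)[OF b(1)[OF nz] X(2)] X(2) by (simp add: lookup_minus)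
    qed
  qed simp

  have "apply_in x S (wedge_series f g) m =
      (SUM n. fls_nth (S (SUM p. f p * g (m - ?x n - p))) n)"
    by (simp add: apply_in_nth wedge_series_def)
  also have "\<dots> = (SUM n. SUM p. fls_nth (S (f p * g (m - ?x n - p))) n)"
    by (simp only: mult_linear_Sum_any[OF mult_linear fin_inner])
  also have "\<dots> = (SUM n. SUM p. SUM i. a p i * b (m - ?x n - p) (n - i))"
    using mult_linear by (simp only: mult_linear_def fls_times_nth_Sum_any a_def b_def)
  also have "\<dots> = (SUM (n, p, i). a p i * b (m - ?x n - p) (n - i))"
  proof (rule Sum_any_nested3)
    have "{(n, p, i). a p i * b (m - ?x n - p) (n - i) \<noteq> 0} \<subseteq> (\<lambda>(i, j, p). (i + j, p, i)) ` {t. h t \<noteq> 0}"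
    proof clarsimp
      fix n p i assume "a p i * b (m - ?x n - p) (n - i) \<noteq> 0"
      moreover have "m - ?x n - p = m - p - ?x n" by (simp add: algebra_simps)
      ultimately have "h (i, n - i, p) \<noteq> 0" by (simp add: h_def)
      then show "(n, p, i) \<in> (\<lambda>(i, j, p). (i + j, p, i)) ` {t. h t \<noteq> 0}"
        by (intro image_eqI[of _ _ "(i, n - i, p)"]) auto
    qed
    then show "finite {(n, p, i). a p i * b (m - ?x n - p) (n - i) \<noteq> 0}"
      by (rule finite_subset) (intro finite_imageI fin)
  qed
  \<comment> \<open>The total power n of x splits into i from the first factor and j = n - i from
    the second.\<close>
  also have "\<dots> = (SUM t. case (case t of (i, j, p) \<Rightarrow> (i + j, p, i)) of
      (n, p, i) \<Rightarrow> a p i * b (m - ?x n - p) (n - i))"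
  proof (rule Sum_any_reindex)
    show "inj (\<lambda>(i :: int, j, p :: expo). (i + j, p, i))" by (auto intro!: injI)
    show "t \<in> range (\<lambda>(i :: int, j, p :: expo). (i + j, p, i))" for t
      by (cases t) (auto intro!: image_eqI[of _ _ "(snd (snd t), fst t - snd (snd t), fst (snd t))"])
  qed
  also have "\<dots> = Sum_any h"
  proof (rule arg_cong[of _ _ Sum_any], rule HOL.ext)
    fix t :: "int \<times> int \<times> expo"
    obtain i j p where t: "t = (i, j, p)" by (cases t)
    have eq: "m - ?x (i + j) - p = m - p - ?x (i + j)" by (simp add: algebra_simps)
    show "(case (case t of (i, j, p) \<Rightarrow> (i + j, p, i)) of
        (n, p, i) \<Rightarrow> a p i * b (m - ?x n - p) (n - i)) = h t"
      unfolding t h_def prod.case add_diff_cancel_left' eq ..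
  qed
  finally have lhs: "apply_in x S (wedge_series f g) m = Sum_any h" .

  have "wedge_series (apply_in x S f) (apply_in x S g) m =
      (SUM q. (SUM i. a (q - ?x i) i) * (SUM j. b (m - q - ?x j) j))"
    by (simp add: apply_in_nth wedge_series_def a_def b_def)
  also have "\<dots> = (SUM q. SUM i. SUM j. a (q - ?x i) i * b (m - q - ?x j) j)"
    by (simp only: Sum_any_product[OF fin_a fin_b])
  also have "\<dots> = (SUM (q, i, j). a (q - ?x i) i * b (m - q - ?x j) j)"
  proof (rule Sum_any_nested3)
    have "{(q, i, j). a (q - ?x i) i * b (m - q - ?x j) j \<noteq> 0} \<subseteq>
        (\<lambda>(i, j, p). (p + ?x i, i, j)) ` {t. h t \<noteq> 0}"
    proof clarsimp
      fix q i j assume nz: "a (q - ?x i) i * b (m - q - ?x j) j \<noteq> 0"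
      have eq: "m - (q - ?x i) - ?x (i + j) = m - q - ?x j"
        by (simp add: single_add algebra_simps)
      have "h (i, j, q - ?x i) \<noteq> 0" unfolding h_def prod.case eq by (rule nz)
      then show "(q, i, j) \<in> (\<lambda>(i, j, p). (p + ?x i, i, j)) ` {t. h t \<noteq> 0}"
        by (intro image_eqI[of _ _ "(i, j, q - ?x i)"]) auto
    qed
    then show "finite {(q, i, j). a (q - ?x i) i * b (m - q - ?x j) j \<noteq> 0}"
      by (rule finite_subset) (intro finite_imageI fin)
  qed
  \<comment> \<open>Now q is the exponent after S has acted on the first factor, hence p shifted by
    i in x.\<close>
  also have "\<dots> = (SUM t. case (case t of (i, j, p) \<Rightarrow> (p + ?x i, i, j)) of
      (q, i, j) \<Rightarrow> a (q - ?x i) i * b (m - q - ?x j) j)"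
  proof (rule Sum_any_reindex)
    show "inj (\<lambda>(i, j :: int, p). (p + ?x i, i, j))" by (auto intro!: injI)
    show "t \<in> range (\<lambda>(i, j :: int, p). (p + ?x i, i, j))" for t
      by (cases t) (auto intro!: image_eqI[of _ _ "(fst (snd t), snd (snd t), fst t - ?x (fst (snd t)))"])
  qed
  also have "\<dots> = Sum_any h"
  proof (rule arg_cong[of _ _ Sum_any], rule HOL.ext)
    fix t :: "int \<times> int \<times> expo"
    obtain i j p where t: "t = (i, j, p)" by (cases t)
    have eq: "m - (p + ?x i) - ?x j = m - p - ?x (i + j)"
      by (simp add: single_add algebra_simps)
    show "(case (case t of (i, j, p) \<Rightarrow> (p + ?x i, i, j)) of
        (q, i, j) \<Rightarrow> a (q - ?x i) i * b (m - q - ?x j) j) = h t"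
      unfolding t h_def prod.case add_diff_cancel_right' eq ..
  qed
  finally show "apply_in x S (wedge_series f g) m = wedge_series (apply_in x S f) (apply_in x S g) m"
    using lhs by simp
qed

section \<open>The operators on $V$\<close>

lemma ext_power_1_induct [consumes 1, case_names bas zero add scale]:
  assumes "v \<in> ext_power 1"
    and "\<And>j::nat. P (bas (int j))" "P 0" "\<And>u v. P u \<Longrightarrow> P v \<Longrightarrow> P (u + v)"
    and "\<And>c v. P v \<Longrightarrow> P (scaleQ c v)"
  shows "P v"
proof -
  have "P (scaleQ (coord v A) (monom_ext A))" if A: "coord v A \<noteq> 0" for A
  proof -
    have "card A = 1" using A assms(1) by (simp add: ext_power_iff)
    then obtain j where "A = {j}" by (rule card_1_singletonE)
    then have "monom_ext A = bas (int j)" by (simp add: bas_def)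
    then show ?thesis using assms(2,5) by simp
  qed
  then have "P (\<Sum>A\<in>S. scaleQ (coord v A) (monom_ext A))" if "S \<subseteq> {A. coord v A \<noteq> 0}" for S
    using that by (induction S rule: infinite_finite_induct) (auto simp: assms(3,4))
  then show ?thesis using ext_expand[of v] by (metis order_refl)
qed

text \<open>The operator U of the overview. Reading it off from \<open>sigma_plus\<close> yields a
  map that is linear on the whole exterior algebra; it shifts indices on V, while on higher degrees
  it is a derivation and serves only as a linear extension.\<close>

definition up_shift :: "ext \<Rightarrow> ext" where
  "up_shift v = fls_nth (sigma_plus v) 1"

lemma up_shift_bas: "up_shift (bas (int j)) = bas (int (Suc j))"
  unfolding up_shift_def sigma_plus_bas_nth by (simp add: add.commute)

lemma linear_up_shift: "Vector_Spaces.linear scaleQ scaleQ up_shift"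
  unfolding up_shift_def by (rule mult_linear_linear[OF sigma_plus(1)])

interpretation up_shift: Vector_Spaces.linear scaleQ scaleQ up_shift
  by (rule linear_up_shift)

interpretation sigma_plus: Vector_Spaces.linear scaleQ scaleQ "\<lambda>u. fls_nth (sigma_plus u) n" for n
  by (rule mult_linear_linear[OF sigma_plus(1)])

interpretation sigma_minus: Vector_Spaces.linear scaleQ scaleQ "\<lambda>u. fls_nth (sigma_minus u) n" for n
  by (rule mult_linear_linear[OF sigma_minus(1)])

lemma up_shift_in_ext_power: "v \<in> ext_power d \<Longrightarrow> up_shift v \<in> ext_power d"
  using graded_sigma_plus by (simp add: up_shift_def graded_def)

lemma funpow_up_shift_in_ext_power: "v \<in> ext_power d \<Longrightarrow> (up_shift ^^ n) v \<in> ext_power d"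
  by (induction n) (simp_all add: up_shift_in_ext_power)

lemma linear_funpow_up_shift: "Vector_Spaces.linear scaleQ scaleQ (up_shift ^^ n)"
  by (induction n) (auto simp: Vector_Spaces.linear_iff ext_vs.vector_space_axioms
      up_shift.add up_shift.scale)

text \<open>In operator form, sigma_+(z) U = z^{-1} (sigma_+(z) - 1) on V; subtracting 1 is the
  cutoff at negative n.\<close>

lemma sigma_plus_up_shift_nth:
  assumes "v \<in> ext_power 1"
  shows "fls_nth (sigma_plus (up_shift v)) n = (if n < 0 then 0 else fls_nth (sigma_plus v) (n + 1))"
  using assms
proof (induction rule: ext_power_1_induct)
  case (bas j)
  show ?case unfolding up_shift_bas sigma_plus_bas_nth by (simp add: algebra_simps)
qed (simp_all add: up_shift.add up_shift.scale up_shift.zero sigma_plus.add sigma_plus.scale sigma_plus.zero)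

lemma sigma_plus_nth_0: "v \<in> ext_power 1 \<Longrightarrow> fls_nth (sigma_plus v) 0 = v"
  by (induction rule: ext_power_1_induct)
    (simp_all add: sigma_plus_bas_nth sigma_plus.add sigma_plus.scale sigma_plus.zero)

text \<open>The convention for b_{-1} matters only at b_0, which is not a shifted basis vector, so
  the formula is uniform on V.\<close>

lemma sigma_minus_up_shift_nth:
  assumes "v \<in> ext_power 1"
  shows "fls_nth (sigma_minus (up_shift v)) n =
    (if n = 0 then up_shift v else if n = - 1 then - v else 0)"
  using assms
proof (induction rule: ext_power_1_induct)
  case (bas j)
  show ?case unfolding up_shift_bas sigma_minus_bas_nth by simp
qed (auto simp: up_shift.add up_shift.scale up_shift.zero sigma_minus.add sigma_minus.scale sigma_minus.zero)

section \<open>Closure of the spaces of series, and the operator 1 - x U\<close>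

lemma series_space_map:
  assumes "f \<in> series_space M X Y" "\<And>v. v \<in> M \<Longrightarrow> L v \<in> M" "L 0 = 0"
  shows "(\<lambda>m. L (f m)) \<in> series_space M X Y"
proof -
  obtain N where "\<And>m. f m \<noteq> 0 \<Longrightarrow> Poly_Mapping.keys m \<subseteq> X"
    "\<And>m x. f m \<noteq> 0 \<Longrightarrow> x \<in> X \<Longrightarrow> Poly_Mapping.lookup m x \<ge> (if x \<in> Y then - int N else 0)"
    using assms(1) by (rule series_spaceE) blast
  moreover have "L (f m) \<noteq> 0 \<Longrightarrow> f m \<noteq> 0" for m using assms(3) by auto
  ultimately show ?thesis
    using assms(1,2) by (intro series_spaceI[of _ _ _ _ N]) (auto simp: series_space_nth)
qed

lemma series_space_diff:
  assumes "f \<in> series_space (ext_power d) X X" "g \<in> series_space (ext_power d) X X"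
  shows "(\<lambda>m. f m - g m) \<in> series_space (ext_power d) X X"
proof -
  obtain N where N: "\<And>m. f m \<noteq> 0 \<Longrightarrow> Poly_Mapping.keys m \<subseteq> X"
    "\<And>m x. f m \<noteq> 0 \<Longrightarrow> x \<in> X \<Longrightarrow> Poly_Mapping.lookup m x \<ge> (if x \<in> X then - int N else 0)"
    using assms(1) by (rule series_spaceE) blast
  obtain N' where N': "\<And>m. g m \<noteq> 0 \<Longrightarrow> Poly_Mapping.keys m \<subseteq> X"
    "\<And>m x. g m \<noteq> 0 \<Longrightarrow> x \<in> X \<Longrightarrow> Poly_Mapping.lookup m x \<ge> (if x \<in> X then - int N' else 0)"
    using assms(2) by (rule series_spaceE) blast
  show ?thesis
  proof (rule series_spaceI[of _ _ _ _ "N + N'"])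
    show "f m - g m \<in> ext_power d" for m
      using assms by (simp add: series_space_nth)
    fix m assume "f m - g m \<noteq> 0"
    then consider "f m \<noteq> 0" | "g m \<noteq> 0" by fastforce
    then show "Poly_Mapping.keys m \<subseteq> X \<and>
        (\<forall>x\<in>X. Poly_Mapping.lookup m x \<ge> (if x \<in> X then - int (N + N') else 0))"
      by cases (use N N' in force)+
  qed
qed

text \<open>Translating the argument by p divides by the monomial with exponent p, which stays in
  the space because poles are allowed in every variable of X.\<close>

lemma series_space_translate:
  assumes f: "f \<in> series_space M X X" and p: "Poly_Mapping.keys p \<subseteq> X"
  shows "(\<lambda>m. f (m + p)) \<in> series_space M X X"
proof -
  obtain N where N: "\<And>m. f m \<noteq> 0 \<Longrightarrow> Poly_Mapping.keys m \<subseteq> X"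
    "\<And>m x. f m \<noteq> 0 \<Longrightarrow> x \<in> X \<Longrightarrow> Poly_Mapping.lookup m x \<ge> (if x \<in> X then - int N else 0)"
    using f by (rule series_spaceE) blast
  obtain K where K: "\<And>y. \<bar>Poly_Mapping.lookup p y\<bar> \<le> K" "0 \<le> K"
    using lookup_bounded[of p] by blast
  show ?thesis
  proof (rule series_spaceI[of _ _ _ _ "N + nat K"])
    show "f (m + p) \<in> M" for m using f by (rule series_space_nth)
    fix m assume nz: "f (m + p) \<noteq> 0"
    have "Poly_Mapping.keys m \<subseteq> X"
      using N(1)[OF nz] p keys_diff[of "m + p" p] by auto
    moreover have "- int (N + nat K) \<le> Poly_Mapping.lookup m x" if "x \<in> X" for x
      using N(2)[OF nz that] K(1)[of x] K(2) that by (simp add: lookup_add)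
    ultimately show "Poly_Mapping.keys m \<subseteq> X \<and>
        (\<forall>x\<in>X. Poly_Mapping.lookup m x \<ge> (if x \<in> X then - int (N + nat K) else 0))"
      by simp
  qed
qed

definition one_minus_up :: "var \<Rightarrow> series \<Rightarrow> series" where
  "one_minus_up x f = (\<lambda>m. f m - up_shift (f (m - Poly_Mapping.single x 1)))"

lemma one_minus_up_series_space:
  assumes "f \<in> series_space (ext_power d) X X" "x \<in> X"
  shows "one_minus_up x f \<in> series_space (ext_power d) X X"
proof -
  have "(\<lambda>m. f (m + - Poly_Mapping.single x 1)) \<in> series_space (ext_power d) X X"
    using assms by (intro series_space_translate) auto
  then have "(\<lambda>m. up_shift (f (m + - Poly_Mapping.single x 1))) \<in> series_space (ext_power d) X X"
    by (rule series_space_map) (auto simp: up_shift_in_ext_power up_shift.zero)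
  then show ?thesis
    unfolding one_minus_up_def using series_space_diff[OF assms(1)] by simp
qed

text \<open>Both operators are polynomials in the single operator U, with multiplication by
  commuting variables.\<close>

lemma one_minus_up_commute:
  "one_minus_up x (one_minus_up y f) = one_minus_up y (one_minus_up x f)"
  by (simp add: one_minus_up_def fun_eq_iff up_shift.diff algebra_simps)

text \<open>On V, sigma_+(x) is the geometric series in x U. At a fixed exponent m the product with
  1 - x U telescopes to the term t 0, and the sum breaks off because the exponents of f are bounded
  below.\<close>

lemma apply_in_sigma_plus_one_minus_up:
  assumes f: "f \<in> series_space (ext_power 1) X X" and x: "x \<in> X"
  shows "apply_in x sigma_plus (one_minus_up x f) = f"
proof
  fix m :: expo
  let ?x = "Poly_Mapping.single x :: int \<Rightarrow> expo"
  define t where "t n = fls_nth (sigma_plus (f (m - ?x n))) n" for n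
  have V: "f p \<in> ext_power 1" for p using f by (rule series_space_nth)
  obtain N where N: "\<And>m x. f m \<noteq> 0 \<Longrightarrow> x \<in> X \<Longrightarrow> Poly_Mapping.lookup m x \<ge> (if x \<in> X then - int N else 0)"
    using f by (rule series_spaceE) blast
  \<comment> \<open>For n beyond L, the exponent of x in \<open>m - ?x n\<close> lies below the
    bound -N for f.\<close>
  define L where "L = nat (Poly_Mapping.lookup m x + int N)"
  have neg: "t n = 0" if "n < 0" for n
    using graded_sigma_plus V that by (fastforce simp: graded_def t_def)
  have large: "t n = 0" if "n > int L" for n
  proof (rule ccontr)
    assume "t n \<noteq> 0"
    then have "f (m - ?x n) \<noteq> 0" by (auto simp: t_def sigma_plus.zero)
    from N[OF this x] x that show False by (simp add: L_def lookup_minus split: if_splits)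
  qed
  \<comment> \<open>The cutoff is essential: without it the term n = -1 would contribute - t 0 and
    the whole sum would vanish.\<close>
  have coeff: "fls_nth (sigma_plus (one_minus_up x f (m - ?x n))) n = (if n < 0 then 0 else t n - t (n + 1))" for n
  proof -
    have eq: "m - ?x n - ?x 1 = m - ?x (n + 1)" by (simp add: single_add algebra_simps)
    have "fls_nth (sigma_plus (one_minus_up x f (m - ?x n))) n =
        t n - (if n < 0 then 0 else t (n + 1))"
      unfolding one_minus_up_def t_def sigma_plus.diff eq by (simp add: sigma_plus_up_shift_nth[OF V])
    then show ?thesis using neg by simp
  qed
  have tele: "(\<Sum>n\<in>{0..int l}. t n - t (n + 1)) = t 0 - t (int l + 1)" for l
  proof (induction l)
    case (Suc l)
    have "{0..int (Suc l)} = insert (int (Suc l)) {0..int l}" by auto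
    then show ?case using Suc by (simp add: algebra_simps)
  qed simp
  have "apply_in x sigma_plus (one_minus_up x f) m = (SUM n. if n < 0 then 0 else t n - t (n + 1))"
    unfolding apply_in_nth coeff ..
  also have "\<dots> = (\<Sum>n\<in>{0..int L}. if n < 0 then 0 else t n - t (n + 1))"
  proof (rule Sum_any.expand_superset)
    show "{n. (if n < 0 then 0 else t n - t (n + 1)) \<noteq> 0} \<subseteq> {0..int L}"
    proof
      fix n assume "n \<in> {n. (if n < 0 then 0 else t n - t (n + 1)) \<noteq> 0}"
      moreover have "t n - t (n + 1) = 0" if "n > int L" using that by (simp add: large)
      ultimately show "n \<in> {0..int L}" by (auto split: if_splits) (metis not_less)
    qed
  qed simp
  also have "\<dots> = (\<Sum>n\<in>{0..int L}. t n - t (n + 1))"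
    by (rule sum.cong) auto
  also have "\<dots> = t 0"
    by (simp add: tele large)
  also have "\<dots> = f m"
    by (simp add: t_def sigma_plus_nth_0[OF V])
  finally show "apply_in x sigma_plus (one_minus_up x f) m = f m" .
qed

text \<open>In operator form: $\overline\sigma_-(x)\, U = - x^{-1} (1 - x U)$ on $V$, where \<open>U\<close> is
  \<^const>\<open>up_shift\<close>.\<close>

lemma apply_in_sigma_minus_up_shift:
  assumes V: "\<And>p. f p \<in> ext_power 1"
  shows "apply_in x sigma_minus (\<lambda>m. up_shift (f m)) =
    one_minus_up x (\<lambda>m. - f (m + Poly_Mapping.single x 1))"
proof
  fix m :: expo
  let ?x = "Poly_Mapping.single x :: int \<Rightarrow> expo"
  have "apply_in x sigma_minus (\<lambda>m. up_shift (f m)) m =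
      (SUM n. if n = 0 then up_shift (f (m - ?x n)) else if n = - 1 then - f (m - ?x n) else 0)"
    unfolding apply_in_nth by (simp add: sigma_minus_up_shift_nth[OF V])
  also have "\<dots> = (\<Sum>n\<in>{- 1, 0}. if n = 0 then up_shift (f (m - ?x n)) else if n = - 1 then - f (m - ?x n) else 0)"
    by (rule Sum_any.expand_superset) (auto split: if_splits)
  also have "\<dots> = - f (m + ?x 1) + up_shift (f m)"
    by (simp add: single_uminus)
  finally show "apply_in x sigma_minus (\<lambda>m. up_shift (f m)) m =
      one_minus_up x (\<lambda>m. - f (m + ?x 1)) m"
    by (simp add: one_minus_up_def up_shift.neg)
qed

section \<open>Products of operators\<close>

definition z_power :: "nat \<Rightarrow> nat \<Rightarrow> expo" where
  "z_power k n = (\<Sum>j<k. Poly_Mapping.single (Z j) (int n))"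

lemma z_power_0: "z_power k 0 = 0"
  by (simp add: z_power_def)

lemma z_power_Suc: "z_power k (Suc n) = z_power k n + z_power k 1"
  by (simp add: z_power_def sum.distrib[symmetric] single_add[symmetric] add.commute)

lemma keys_z_power: "Poly_Mapping.keys (z_power k n) \<subseteq> Z ` {..<k}"
  using keys_sum[of "\<lambda>j. Poly_Mapping.single (Z j) (int n)" "{..<k}"]
  by (fastforce simp: z_power_def split: if_splits)

lemma foldr_one_minus_up_series_space:
  assumes "f \<in> series_space (ext_power d) X X" "Z ` set js \<subseteq> X"
  shows "foldr (\<lambda>j. one_minus_up (Z j)) js f \<in> series_space (ext_power d) X X"
  using assms(2) by (induction js) (auto simp: assms(1) one_minus_up_series_space)

lemma foldr_one_minus_up_commute:
  "foldr (\<lambda>j. one_minus_up (Z j)) js (one_minus_up x f) = one_minus_up x (foldr (\<lambda>j. one_minus_up (Z j)) js f)"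
  by (induction js) (simp_all add: one_minus_up_commute)

text \<open>Each sigma_-(z_j) consumes one of the k shifts and leaves - z_j^{-1} (1 - z_j U). The k
  factors -1 and the inverse variables combine into the scalar and the translation by
  \<open>z_power k 1\<close>.\<close>

lemma foldr_sigma_minus_up_shift:
  assumes "f \<in> series_space (ext_power 1) X X" "Z ` {..<k} \<subseteq> X"
  shows "foldr (\<lambda>j. apply_in (Z j) sigma_minus) [0..<k] (\<lambda>m. (up_shift ^^ k) (f m)) =
    foldr (\<lambda>j. one_minus_up (Z j)) [0..<k] (\<lambda>m. scaleQ ((- 1) ^ k) (f (m + z_power k 1)))"
  using assms
proof (induction k arbitrary: f)
  case 0
  then show ?case by (simp add: z_power_def)
next
  case (Suc k)
  let ?z = "Poly_Mapping.single (Z k) (1::int)"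
  \<comment> \<open>This is - z^{-1} (1 - z U) f for the last variable z, the one that
    \<open>foldr\<close> treats first. The remaining k shifts commute with it, so the induction
    hypothesis applies to g; this is why f is arbitrary in the induction.\<close>
  define g where "g = one_minus_up (Z k) (\<lambda>m. - f (m + ?z))"
  interpret L: Vector_Spaces.linear scaleQ scaleQ "up_shift ^^ k"
    by (rule linear_funpow_up_shift)
  have X: "Z ` {..<k} \<subseteq> X" "Z k \<in> X" using Suc.prems(2) by auto
  have "(\<lambda>m. f (m + ?z)) \<in> series_space (ext_power 1) X X"
    using Suc.prems(1) X(2) by (intro series_space_translate) auto
  then have "(\<lambda>m. - f (m + ?z)) \<in> series_space (ext_power 1) X X"
    by (rule series_space_map) auto
  then have g: "g \<in> series_space (ext_power 1) X X"
    unfolding g_def using X(2) by (rule one_minus_up_series_space)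
  have V: "(up_shift ^^ k) (f p) \<in> ext_power 1" for p
    using Suc.prems(1) by (intro funpow_up_shift_in_ext_power series_space_nth)
  have "apply_in (Z k) sigma_minus (\<lambda>m. (up_shift ^^ Suc k) (f m)) =
      one_minus_up (Z k) (\<lambda>m. - (up_shift ^^ k) (f (m + ?z)))"
    using apply_in_sigma_minus_up_shift[of "\<lambda>m. (up_shift ^^ k) (f m)", OF V] by simp
  also have "\<dots> = (\<lambda>m. (up_shift ^^ k) (g m))"
    by (simp add: g_def one_minus_up_def fun_eq_iff L.diff L.neg up_shift.neg funpow_swap1)
  finally have "foldr (\<lambda>j. apply_in (Z j) sigma_minus) [0..<Suc k] (\<lambda>m. (up_shift ^^ Suc k) (f m)) =
      foldr (\<lambda>j. apply_in (Z j) sigma_minus) [0..<k] (\<lambda>m. (up_shift ^^ k) (g m))"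
    by simp
  also have "\<dots> = foldr (\<lambda>j. one_minus_up (Z j)) [0..<k] (\<lambda>m. scaleQ ((- 1) ^ k) (g (m + z_power k 1)))"
    by (rule Suc.IH[OF g X(1)])
  also have "(\<lambda>m. scaleQ ((- 1) ^ k) (g (m + z_power k 1))) =
      one_minus_up (Z k) (\<lambda>m. scaleQ ((- 1) ^ Suc k) (f (m + z_power (Suc k) 1)))"
  proof
    fix m
    have eq: "m + z_power k 1 + ?z = m + z_power (Suc k) 1"
      "m + z_power k 1 - ?z + ?z = m - ?z + z_power (Suc k) 1"
      by (simp_all add: z_power_def algebra_simps)
    show "scaleQ ((- 1) ^ k) (g (m + z_power k 1)) =
        one_minus_up (Z k) (\<lambda>m. scaleQ ((- 1) ^ Suc k) (f (m + z_power (Suc k) 1))) m"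
      unfolding g_def one_minus_up_def eq up_shift.scale up_shift.neg
      by (simp add: ext_vs.scale_right_diff_distrib)
  qed
  finally show ?case by simp
qed

text \<open>On both lists the last variable is applied first, so sigma_+ in that variable does not
  meet its own factor directly; commuting this factor to the outside lets the two cancel.\<close>

lemma foldr_sigma_plus_one_minus_up:
  assumes "f \<in> series_space (ext_power 1) X X" "Z ` {..<k} \<subseteq> X"
  shows "foldr (\<lambda>j. apply_in (Z j) sigma_plus) [0..<k] (foldr (\<lambda>j. one_minus_up (Z j)) [0..<k] f) = f"
  using assms
proof (induction k)
  case (Suc k)
  have "foldr (\<lambda>j. one_minus_up (Z j)) [0..<k] f \<in> series_space (ext_power 1) X X"
    using Suc.prems by (intro foldr_one_minus_up_series_space) auto
  then show ?case
    using Suc by (simp add: foldr_one_minus_up_commute apply_in_sigma_plus_one_minus_up[of _ X] lessThan_Suc)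
qed simp

lemma foldr_apply_in_series_space:
  assumes "graded S c" "f \<in> series_space (ext_power d) X Y" "Z ` set js \<subseteq> X" "Z ` set js \<subseteq> Y \<or> c = 0"
  shows "foldr (\<lambda>j. apply_in (Z j) S) js f \<in> series_space (ext_power d) X Y"
  using assms(3,4) by (induction js) (auto simp: assms(2) intro!: apply_in_series_space[OF assms(1)])

lemma foldr_apply_in_wedge_series:
  assumes "graded S c" "finite X" "f \<in> series_space (ext_power d) X X"
    "g \<in> series_space (ext_power e) X X" "Z ` set js \<subseteq> X"
  shows "foldr (\<lambda>j. apply_in (Z j) S) js (wedge_series f g) =
    wedge_series (foldr (\<lambda>j. apply_in (Z j) S) js f) (foldr (\<lambda>j. apply_in (Z j) S) js g)"
  using assms(5)
proof (induction js)
  case (Cons j js)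
  have "foldr (\<lambda>j. apply_in (Z j) S) js f \<in> series_space (ext_power d) X X"
    "foldr (\<lambda>j. apply_in (Z j) S) js g \<in> series_space (ext_power e) X X"
    using assms Cons.prems by (auto intro!: foldr_apply_in_series_space[OF assms(1)])
  then show ?case
    using Cons by (simp add: apply_in_wedge_series[OF assms(1,2)])
qed simp

lemma sigma_plus_z_eq: "sigma_plus_z k = foldr (\<lambda>j. apply_in (Z j) sigma_plus) [0..<k]"
  and sigma_minus_z_eq: "sigma_minus_z k = foldr (\<lambda>j. apply_in (Z j) sigma_minus) [0..<k]"
  by (simp_all add: fun_eq_iff sigma_plus_z_def sigma_minus_z_def apply_in_def)

section \<open>The composite operator as a multiplicative map\<close>

lemma const_series_space: "u \<in> M \<Longrightarrow> 0 \<in> M \<Longrightarrow> const_series u \<in> series_space M X Y"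
  by (rule series_spaceI[of _ _ _ _ 0]) (auto simp: const_series_def split: if_splits)

lemma wedge_series_single:
  "wedge_series (\<lambda>m. if m + q = 0 then c else 0) g = (\<lambda>m. c * g (m + q))"
proof
  fix m
  have "wedge_series (\<lambda>m. if m + q = 0 then c else 0) g m =
      (\<Sum>p\<in>{- q}. (if p + q = 0 then c else 0) * g (m - p))"
    unfolding wedge_series_def
    by (rule Sum_any.expand_superset) (auto simp: add_eq_0_iff2 split: if_splits)
  then show "wedge_series (\<lambda>m. if m + q = 0 then c else 0) g m = c * g (m + q)" by simp
qed

lemma const_series_times: "const_series (u * v) = wedge_series (const_series u) (const_series v)"
  using wedge_series_single[of 0 u "const_series v"] by (auto simp: const_series_def fun_eq_iff)

text \<open>The composite without the change of length from r to r + k that is built into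
  \<open>Gamma\<close>. It is multiplicative, which \<open>Gamma\<close> in general is not.\<close>

definition vertex :: "nat \<Rightarrow> ext \<Rightarrow> series" where
  "vertex k u = sigma_plus_z k (sigma_minus_z k (const_series u))"

lemma vertex_times:
  assumes "u \<in> ext_power d" "v \<in> ext_power e"
  shows "vertex k (u * v) = wedge_series (vertex k u) (vertex k v)"
proof -
  let ?X = "Z ` {..<k}"
  have c: "const_series u \<in> series_space (ext_power d) ?X ?X" "const_series v \<in> series_space (ext_power e) ?X ?X"
    using assms by (simp_all add: const_series_space)
  then have "sigma_minus_z k (const_series u) \<in> series_space (ext_power d) ?X ?X"
    "sigma_minus_z k (const_series v) \<in> series_space (ext_power e) ?X ?X"
    unfolding sigma_minus_z_eq
    by (auto intro!: foldr_apply_in_series_space[OF graded_sigma_minus] simp: lessThan_atLeast0)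
  then show ?thesis
    unfolding vertex_def const_series_times sigma_minus_z_eq sigma_plus_z_eq
    by (subst foldr_apply_in_wedge_series[OF graded_sigma_minus _ c])
      (auto intro!: foldr_apply_in_wedge_series[OF graded_sigma_plus, of ?X] simp: lessThan_atLeast0)
qed

text \<open>The index a + k supplies the k shifts that the sigma_- operators consume. The result is
  a single monomial with exponent \<open>- z_power k 1\<close>, written in the shape that
  \<open>wedge_series_single\<close> expects.\<close>

lemma vertex_bas:
  "vertex k (bas (int (a + k))) =
    (\<lambda>m. if m + z_power k 1 = 0 then scaleQ ((- 1) ^ k) (bas (int a)) else 0)"
proof -
  let ?X = "Z ` {..<k}"
  interpret L: Vector_Spaces.linear scaleQ scaleQ "up_shift ^^ k"
    by (rule linear_funpow_up_shift)
  have f: "const_series (bas (int a)) \<in> series_space (ext_power 1) ?X ?X"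
    by (rule const_series_space[OF bas_in_ext_power]) simp
  have bas: "(up_shift ^^ n) (bas (int a)) = bas (int (a + n))" for n
    by (induction n) (simp_all add: up_shift_bas del: of_nat_add of_nat_Suc)
  have "const_series (bas (int (a + k))) = (\<lambda>m. (up_shift ^^ k) (const_series (bas (int a)) m))"
    unfolding const_series_def bas[symmetric] by (auto simp: L.zero)
  then have "vertex k (bas (int (a + k))) = foldr (\<lambda>j. apply_in (Z j) sigma_plus) [0..<k]
      (foldr (\<lambda>j. one_minus_up (Z j)) [0..<k] (\<lambda>m. scaleQ ((- 1) ^ k) (const_series (bas (int a)) (m + z_power k 1))))"
    unfolding vertex_def sigma_plus_z_eq sigma_minus_z_eq
    by (simp only: foldr_sigma_minus_up_shift[OF f order_refl])
  also have "\<dots> = (\<lambda>m. scaleQ ((- 1) ^ k) (const_series (bas (int a)) (m + z_power k 1)))"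
  proof (rule foldr_sigma_plus_one_minus_up[OF _ order_refl])
    have "(\<lambda>m. const_series (bas (int a)) (m + z_power k 1)) \<in> series_space (ext_power 1) ?X ?X"
      by (rule series_space_translate[OF f keys_z_power])
    then show "(\<lambda>m. scaleQ ((- 1) ^ k) (const_series (bas (int a)) (m + z_power k 1)))
        \<in> series_space (ext_power 1) ?X ?X"
      by (rule series_space_map) auto
  qed
  finally show ?thesis by (auto simp: const_series_def fun_eq_iff)
qed

lemma prod_list_bas_in_ext_power: "prod_list (map (\<lambda>a. bas (g a)) as) \<in> ext_power (length as)"
proof (induction as)
  case (Cons a as)
  then show ?case using ext_power_times[OF bas_in_ext_power[of "g a"] Cons.IH] by simp
qed (simp add: one_in_ext_power)

text \<open>Writing the indices as a + k builds in that they are at least k. Each such factor then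
  passes through as b_a times a scalar and a monomial, whatever homogeneous w follows.\<close>

lemma vertex_prod_bas:
  assumes w: "w \<in> ext_power e"
  shows "vertex k (prod_list (map (\<lambda>a. bas (int (a + k))) as) * w) =
    (\<lambda>m. scaleQ ((- 1) ^ (k * length as))
      (prod_list (map (\<lambda>a. bas (int a)) as) * vertex k w (m + z_power k (length as))))"
proof (induction as)
  case Nil
  then show ?case by (simp add: z_power_0)
next
  case (Cons a as)
  let ?p = "prod_list (map (\<lambda>a. bas (int (a + k))) as) * w"
  have "?p \<in> ext_power (length as + e)"
    by (intro ext_power_times prod_list_bas_in_ext_power w)
  then have "vertex k (bas (int (a + k)) * ?p) = wedge_series (vertex k (bas (int (a + k)))) (vertex k ?p)"
    by (rule vertex_times[OF bas_in_ext_power])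
  also have "\<dots> = (\<lambda>m. scaleQ ((- 1) ^ k) (bas (int a)) * vertex k ?p (m + z_power k 1))"
    unfolding vertex_bas wedge_series_single ..
  also have "\<dots> = (\<lambda>m. scaleQ ((- 1) ^ (k * length (a # as)))
      (prod_list (map (\<lambda>a. bas (int a)) (a # as)) * vertex k w (m + z_power k (length (a # as)))))"
  proof
    fix m
    have eq: "m + z_power k 1 + z_power k (length as) = m + z_power k (length (a # as))"
      by (simp add: z_power_Suc[of k "length as"] algebra_simps)
    show "scaleQ ((- 1) ^ k) (bas (int a)) * vertex k ?p (m + z_power k 1) =
        scaleQ ((- 1) ^ (k * length (a # as)))
          (prod_list (map (\<lambda>a. bas (int a)) (a # as)) * vertex k w (m + z_power k (length (a # as))))"
      unfolding Cons.IH eq by (simp add: scaleQ_mult mult.assoc power_add mult.commute)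
  qed
  finally show ?case by (simp add: mult.assoc)
qed

section \<open>The vector of the empty partition and the comparison with the vertex operator\<close>

lemma b_part_empty_Suc: "b_part (Suc k) (\<lambda>_. 0) = bas (int k) * b_part k (\<lambda>_. 0)"
  unfolding b_part_def
  by (simp add: upt_conv_Cons[of 0 "Suc k"] map_Suc_upt[symmetric] o_def algebra_simps del: upt_Suc)

text \<open>The correction term of the leading factor b_k is a multiple of b_{k-1}, which is already
  the leading factor of the remaining product and so annihilates it. For k = 0 it is zero by the
  convention on negative indices.\<close>

lemma sigma_minus_b_part_empty: "sigma_minus (b_part k (\<lambda>_. 0)) = fls_const (b_part k (\<lambda>_. 0))"
proof (induction k)
  case 0
  then show ?case using sigma_minus(1) by (simp add: b_part_def mult_linear_def)
next
  case (Suc k)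
  let ?b = "b_part k (\<lambda>_. 0)"
  have "bas (int k - 1) * ?b = 0"
  proof (cases k)
    case (Suc l)
    then show ?thesis
      by (simp add: b_part_empty_Suc mult.assoc[symmetric] bas_relations(1))
  qed (simp add: bas_def)
  then have "fls_const (bas (int k - 1)) * fls_X_inv * fls_const ?b = 0"
    by (simp add: mult.assoc fls_X_inv_times_conv_shift fls_eq_iff fls_const_nth)
  moreover have "sigma_minus (b_part (Suc k) (\<lambda>_. 0)) =
      (fls_const (bas (int k)) - fls_const (bas (int k - 1)) * fls_X_inv) * fls_const ?b"
    using sigma_minus by (simp add: b_part_empty_Suc mult_linear_def Suc.IH)
  ultimately show ?case
    by (simp only: left_diff_distrib fls_const_mult_const b_part_empty_Suc diff_zero)
qed

lemma vertex_b_part_empty: "vertex k (b_part l (\<lambda>_. 0)) = sigma_plus_z k (const_series (b_part l (\<lambda>_. 0)))"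
proof -
  let ?b = "b_part l (\<lambda>_. 0)"
  have "apply_in x sigma_minus (const_series ?b) = const_series ?b" for x
  proof
    fix m
    have "apply_in x sigma_minus (const_series ?b) m = in_var x (sigma_minus ?b) m"
    proof -
      have "apply_in x sigma_minus (const_series ?b) m =
          (\<Sum>p\<in>{0}. in_var x (sigma_minus (const_series ?b p)) (m - p))"
        unfolding apply_in_def extend_def
        by (rule Sum_any.expand_superset)
          (auto simp: const_series_def mult_linear_zero[OF sigma_minus(1)] in_var_def split: if_splits)
      then show ?thesis by (simp add: const_series_def)
    qed
    also have "\<dots> = const_series ?b m"
      by (auto simp: in_var_def const_series_def sigma_minus_b_part_empty keys_subset_single_iff)
    finally show "apply_in x sigma_minus (const_series ?b) m = const_series ?b m" .
  qed
  then have "foldr (\<lambda>j. apply_in (Z j) sigma_minus) js (const_series ?b) = const_series ?b" for js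
    by (induction js) auto
  then show ?thesis by (simp add: vertex_def sigma_minus_z_eq)
qed

lemma Gamma:
  "Vector_Spaces.linear scaleQ scaleQ (\<lambda>u. Gamma k u m)"
  "lam \<in> partitions r \<Longrightarrow> Gamma k (b_part r lam) = vertex k (b_part (r + k) lam)"
  using theI'[OF linear_b_part_ex1[of "\<lambda>r lam. vertex k (b_part (r + k) lam)"]]
  unfolding Gamma_def vertex_def by blast+

text \<open>Beyond position r the parts vanish, so the last k factors are those of the empty
  partition. Before it, i < r makes the truncated subtraction \<open>r - 1 - i\<close> exact, and
  the index exceeds the one in length r by k.\<close>

lemma b_part_add:
  assumes "lam \<in> partitions r"
  shows "b_part (r + k) lam =
    prod_list (map (\<lambda>a. bas (int (a + k))) (map (\<lambda>i. r - 1 - i + lam i) [0..<r])) * b_part k (\<lambda>_. 0)"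
proof -
  have eq: "map (\<lambda>i. bas (int (r + k) - 1 - int i + int (lam i))) [0..<r + k] =
      map (\<lambda>a. bas (int (a + k))) (map (\<lambda>i. r - 1 - i + lam i) [0..<r]) @
      map (\<lambda>i. bas (int k - 1 - int i + int 0)) [0..<k]"
  proof (rule nth_equalityI)
    fix i assume "i < length (map (\<lambda>i. bas (int (r + k) - 1 - int i + int (lam i))) [0..<r + k])"
    then have "i < r + k" by simp
    moreover have "lam i = 0" if "r \<le> i" using assms that by (simp add: partitions_def)
    ultimately show "map (\<lambda>i. bas (int (r + k) - 1 - int i + int (lam i))) [0..<r + k] ! i =
        (map (\<lambda>a. bas (int (a + k))) (map (\<lambda>i. r - 1 - i + lam i) [0..<r]) @
        map (\<lambda>i. bas (int k - 1 - int i + int 0)) [0..<k]) ! i"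
      by (cases "i < r") (auto simp: nth_append intro!: arg_cong[of _ _ bas])
  qed simp
  show ?thesis unfolding b_part_def eq prod_list.append ..
qed

lemma b_part_eq_prod_list: "b_part r lam = prod_list (map (\<lambda>a. bas (int a)) (map (\<lambda>i. r - 1 - i + lam i) [0..<r]))"
  unfolding b_part_def map_map
  by (intro arg_cong[of _ _ prod_list] map_cong refl) (auto intro!: arg_cong[of _ _ bas])

text \<open>Supplies both facts needed about the left factor: there are no poles in the z-variables,
  since c = 0 for sigma_+, and all coefficients have degree k, which determines the sign when they
  are moved.\<close>

lemma sigma_plus_b_part_empty_series_space:
  "sigma_plus_z k (const_series (b_part k (\<lambda>_. 0))) \<in> series_space (ext_power k) (Z ` {..<k}) {}"
  unfolding sigma_plus_z_eq
  by (rule foldr_apply_in_series_space[OF graded_sigma_plus])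
    (auto simp: const_series_space b_part_in_ext_power)

text \<open>The asserted identity for a single vector v, read off at the exponent m; the power of
  the z-variables appears as the translation by \<open>z_power k r\<close>. Linearity reduces it to
  basis vectors.\<close>

lemma Gamma_eq:
  assumes v: "v \<in> ext_power r"
  shows "Gamma k v m = sigma_plus_z k (const_series (b_part k (\<lambda>_. 0))) (m + z_power k r) * v"
proof -
  let ?A = "sigma_plus_z k (const_series (b_part k (\<lambda>_. 0)))"
  interpret G: Vector_Spaces.linear scaleQ scaleQ "\<lambda>u. Gamma k u m"
    by (rule Gamma(1))
  have *: "Gamma k (monom_ext B) m = ?A (m + z_power k r) * monom_ext B" if B: "coord v B \<noteq> 0" for B
  proof -
    have "finite B" "card B = r" using B v coord_infinite by (auto simp: ext_power_iff)
    then obtain lam where lam: "lam \<in> partitions r" "part_set r lam = B"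
      using part_set_surj by blast
    have "Gamma k (b_part r lam) m =
        scaleQ ((- 1) ^ (k * r)) (b_part r lam * ?A (m + z_power k r))"
      unfolding Gamma(2)[OF lam(1)] b_part_add[OF lam(1)] vertex_prod_bas[OF b_part_in_ext_power]
        vertex_b_part_empty b_part_eq_prod_list[of r lam, symmetric] by simp
    \<comment> \<open>The exchange sign equals the sign already present, so the two cancel.\<close>
    also have "b_part r lam * ?A (m + z_power k r) =
        scaleQ ((- 1) ^ (k * r)) (?A (m + z_power k r) * b_part r lam)"
      by (rule ext_power_commute[OF series_space_nth[OF sigma_plus_b_part_empty_series_space] b_part_in_ext_power])
    finally show ?thesis
      using b_part_eq_monom[OF lam(1)] lam(2) by (simp add: power_mult_distrib[symmetric])
  qed
  have "Gamma k v m = Gamma k (\<Sum>B | coord v B \<noteq> 0. scaleQ (coord v B) (monom_ext B)) m"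
    using ext_expand[of v] by simp
  also have "\<dots> = (\<Sum>B | coord v B \<noteq> 0. scaleQ (coord v B) (?A (m + z_power k r) * monom_ext B))"
    unfolding G.sum G.scale using * by (intro sum.cong) auto
  also have "\<dots> = ?A (m + z_power k r) * (\<Sum>B | coord v B \<noteq> 0. scaleQ (coord v B) (monom_ext B))"
    by (simp add: sum_distrib_left scaleQ_mult)
  finally show ?thesis using ext_expand[of v] by simp
qed

theorem theorem5p5:
  fixes k r :: nat and u :: series
  assumes "k \<ge> 1"
    and "u \<in> series_space (ext_power r) (W ` {..<k}) (W ` {..<k})"
  shows "wedge_series (sigma_plus_z k (const_series (b_part k (\<lambda>_. 0)))) u
      \<in> series_space (ext_power (r + k)) (Z ` {..<k} \<union> W ` {..<k}) (W ` {..<k})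
    \<and> wedge_series (sigma_plus_z k (const_series (b_part k (\<lambda>_. 0)))) u
      = monomial_times (\<Sum>j<k. Poly_Mapping.single (Z j) (int r)) (extend (Gamma k) u)"
proof
  let ?A = "sigma_plus_z k (const_series (b_part k (\<lambda>_. 0)))"
  note A = sigma_plus_b_part_empty_series_space[of k]
  obtain N where N: "\<And>m. ?A m \<noteq> 0 \<Longrightarrow> Poly_Mapping.keys m \<subseteq> Z ` {..<k}"
    "\<And>m x. ?A m \<noteq> 0 \<Longrightarrow> x \<in> Z ` {..<k} \<Longrightarrow> Poly_Mapping.lookup m x \<ge> (if x \<in> {} then - int N else 0)"
    using A by (rule series_spaceE) blast
  obtain N' where N': "\<And>m. u m \<noteq> 0 \<Longrightarrow> Poly_Mapping.keys m \<subseteq> W ` {..<k}"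
    "\<And>m x. u m \<noteq> 0 \<Longrightarrow> x \<in> W ` {..<k} \<Longrightarrow>
      Poly_Mapping.lookup m x \<ge> (if x \<in> W ` {..<k} then - int N' else 0)"
    using assms(2) by (rule series_spaceE) blast
  \<comment> \<open>The variables Z and W are disjoint: z-exponents come only from the left factor,
    where they are nonnegative, and w-exponents only from u. So the bound N' for u serves for the
    product.\<close>
  show "wedge_series ?A u \<in> series_space (ext_power (r + k)) (Z ` {..<k} \<union> W ` {..<k}) (W ` {..<k})"
  proof (rule series_spaceI[of _ _ _ _ N'])
    show "wedge_series ?A u m \<in> ext_power (r + k)" for m
      unfolding wedge_series_def add.commute[of r]
      by (intro ext_power_Sum_any ext_power_times series_space_nth[OF A] series_space_nth[OF assms(2)])
    fix m assume "wedge_series ?A u m \<noteq> 0"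
    then obtain p where "?A p * u (m - p) \<noteq> 0"
      unfolding wedge_series_def by (rule Sum_any_nonzeroE)
    then have nz: "?A p \<noteq> 0" "u (m - p) \<noteq> 0" by (auto dest: ext_mult_nonzeroD)
    note p = N(1)[OF nz(1)] and q = N'(1)[OF nz(2)]
    have "Poly_Mapping.lookup m x \<ge> (if x \<in> W ` {..<k} then - int N' else 0)"
      if "x \<in> Z ` {..<k} \<union> W ` {..<k}" for x
    proof (cases "x \<in> W ` {..<k}")
      case True
      then have "Poly_Mapping.lookup p x = 0" using p by (auto simp: not_in_keys_iff_lookup_eq_zero[symmetric])
      then show ?thesis using N'(2)[OF nz(2) True] by (simp add: lookup_minus)
    next
      case False
      then have x: "x \<in> Z ` {..<k}" using that by simp
      have "Poly_Mapping.lookup (m - p) x = 0"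
        using q False by (auto simp: not_in_keys_iff_lookup_eq_zero[symmetric])
      then show ?thesis using N(2)[OF nz(1) x] False by (simp add: lookup_minus)
    qed
    then show "Poly_Mapping.keys m \<subseteq> Z ` {..<k} \<union> W ` {..<k} \<and>
        (\<forall>x\<in>Z ` {..<k} \<union> W ` {..<k}. Poly_Mapping.lookup m x \<ge> (if x \<in> W ` {..<k} then - int N' else 0))"
      using p q keys_subset_Un_diff[of m p] by blast
  qed
  show "wedge_series ?A u = monomial_times (\<Sum>j<k. Poly_Mapping.single (Z j) (int r)) (extend (Gamma k) u)"
  proof
    fix m :: expo
    \<comment> \<open>\<open>extend\<close> sums over the exponents of u,
      \<open>wedge_series\<close> over those of the left factor; the reflection of p into m - p
      exchanges the two.\<close>
    have inj: "inj (\<lambda>p. m - p)" by (auto intro: injI)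
    have surj: "p \<in> range (\<lambda>p. m - p)" for p by (rule range_eqI[of _ _ "m - p"]) simp
    have "monomial_times (z_power k r) (extend (Gamma k) u) m =
        (SUM p. Gamma k (u p) (m - z_power k r - p))"
      by (simp add: monomial_times_def extend_def)
    also have "\<dots> = (SUM p. ?A (m - p) * u p)"
      by (simp add: Gamma_eq[OF series_space_nth[OF assms(2)]] algebra_simps)
    also have "\<dots> = (SUM p. ?A p * u (m - p))"
      using Sum_any_reindex[OF inj, of "\<lambda>p. ?A (m - p) * u p"] surj by simp
    finally show "wedge_series ?A u m =
        monomial_times (\<Sum>j<k. Poly_Mapping.single (Z j) (int r)) (extend (Gamma k) u) m"
      by (simp add: wedge_series_def z_power_def)
  qed
qed

end
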